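(* Let $K$ be the Bessel-Kingman hypergroup of order $\nu\ge 0$, and for $\lambda\in\mathbb R_0=[0,\infty)$ let $\alpha_\lambda^\nu\in\widehat K$ be its character with parameter $\lambda$. If $\nu=0$ or $\nu\ge\frac12$, then $K$ is $\alpha_\lambda^\nu$-amenable if and only if $\alpha_\lambda^\nu=1$.
   Context: The Bessel-Kingman hypergroup of order $\nu$ is the Sturm-Liouville (Chébli-Trimèche) hypergroup on $\mathbb R_0=[0,\infty)$ associated with $A(x)=x^{2\nu+1}$; it is commutative with identity $0$, identity involution and Haar measure $x^{2\nu+1}dx$. For $\nu>-\frac12$ its convolution is given by $$\int f\,d\omega(x,y)=\frac{\Gamma(\nu+1)}{\Gamma(\frac12)\Gamma(\nu+\frac12)}\int_0^\pi f\big(\sqrt{x^2+y^2-2xy\cos\theta}\big)\sin^{2\nu}\theta\,d\theta .$$ Its characters are $\alpha_\lambda^\nu(x)=2^\nu\Gamma(\nu+1)J_\nu(\lambda x)(\lambda x)^{-\nu}$, $\lambda\in\mathbb R_0$, where $J_\nu$ is the Bessel function of order $\nu$ (with the value at $\lambda x=0$ equal to $1$ by continuity, so $\alpha_0^\nu=1$). Translation is $T_xf(y)=\int_K f(t)\,d\omega(x,y)(t)$. For a commutative hypergroup $K$ and a character $\alpha\in\widehat K$, $K$ is called $\alpha$-amenable if there is a bounded linear functional $m_\alpha\in L^\infty(K)^*$ with $m_\alpha(\alpha)=1$ and $m_\alpha(T_xf)=\alpha(x)m_\alpha(f)$ for all $f\in L^\infty(K)$, $x\in K$. *)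

theory Defs
  imports "HOL-Probability.Probability"
begin

text \<open>The integrals below are Bochner integrals, and functions on the hypergroup
  \<open>[0, \<infinity>)\<close> are total functions on the reals, of which only the values on
  the space of the Haar measure matter.\<close>

definition Linfty_norm :: "'a measure \<Rightarrow> ('a \<Rightarrow> complex) \<Rightarrow> real" where
  "Linfty_norm M f = real_of_ereal (esssup M (\<lambda>x. ereal (cmod (f x))))"

definition Linfty :: "'a measure \<Rightarrow> ('a \<Rightarrow> complex) set" where
  "Linfty M = {f \<in> borel_measurable M. esssup M (\<lambda>x. ereal (cmod (f x))) < \<infinity>}"

text \<open>Elements of the dual of \<open>L\<^sup>\<infinity>\<close>. Functions are not identified modulo null sets,
  but \<^const>\<open>Linfty_norm\<close> is only a seminorm, so the norm bound together with linearity
  makes \<open>m\<close> take equal values on functions in \<open>Linfty M\<close> that agree almost everywhere;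
  \<open>m\<close> thus is exactly a bounded functional on the quotient.\<close>

definition Linfty_functional :: "'a measure \<Rightarrow> (('a \<Rightarrow> complex) \<Rightarrow> complex) \<Rightarrow> bool" where
  "Linfty_functional M m \<longleftrightarrow>
     (\<forall>f\<in>Linfty M. \<forall>g\<in>Linfty M. m (\<lambda>x. f x + g x) = m f + m g) \<and>
     (\<forall>c. \<forall>f\<in>Linfty M. m (\<lambda>x. c * f x) = c * m f) \<and>
     (\<exists>C. \<forall>f\<in>Linfty M. cmod (m f) \<le> C * Linfty_norm M f)"

definition translation ::
    "('a \<Rightarrow> 'a \<Rightarrow> 'a measure) \<Rightarrow> 'a \<Rightarrow> ('a \<Rightarrow> complex) \<Rightarrow> 'a \<Rightarrow> complex" where
  "translation \<omega> x f y = (\<integral>t. f t \<partial>\<omega> x y)"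

text \<open>A commutative hypergroup enters through its Haar measure \<open>M\<close> (whose space is the
  hypergroup) and its convolution of point measures \<open>\<omega> x y\<close>; \<open>\<alpha>\<close> is a character.\<close>

definition alpha_amenable ::
    "'a measure \<Rightarrow> ('a \<Rightarrow> 'a \<Rightarrow> 'a measure) \<Rightarrow> ('a \<Rightarrow> complex) \<Rightarrow> bool" where
  "alpha_amenable M \<omega> \<alpha> \<longleftrightarrow>
     (\<exists>m. Linfty_functional M m \<and> m \<alpha> = 1 \<and>
          (\<forall>f\<in>Linfty M. \<forall>x\<in>space M. m (translation \<omega> x f) = \<alpha> x * m f))"

definition BK_haar :: "real \<Rightarrow> real measure" where
  "BK_haar \<nu> = density (restrict_space lborel {0..}) (\<lambda>x. ennreal (x powr (2 * \<nu> + 1)))"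

text \<open>For \<open>\<nu> > -1/2\<close>: the image of the probability measure with density proportional to
  \<open>sin \<theta> powr (2 * \<nu>)\<close> on \<open>[0, \<pi>]\<close>. For \<open>\<nu> = 0\<close> this density is constant up to the
  end points (\<open>0 powr 0 = 0\<close>), which are a null set.\<close>

definition BK_conv :: "real \<Rightarrow> real \<Rightarrow> real \<Rightarrow> real measure" where
  "BK_conv \<nu> x y =
     distr
       (density (restrict_space lborel {0..pi})
         (\<lambda>\<theta>. ennreal (Gamma (\<nu> + 1) / (Gamma (1 / 2) * Gamma (\<nu> + 1 / 2)) * sin \<theta> powr (2 * \<nu>))))
       (restrict_space borel {0..})
       (\<lambda>\<theta>. sqrt (x\<^sup>2 + y\<^sup>2 - 2 * x * y * cos \<theta>))"

text \<open>Bessel function of the first kind, for \<open>z > 0\<close> (at \<open>z = 0\<close> the real power would give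
  the wrong value for order \<open>0\<close>).\<close>

definition Bessel_J :: "real \<Rightarrow> real \<Rightarrow> real" where
  "Bessel_J \<nu> z =
     (\<Sum>k. (-1) ^ k / (fact k * Gamma (\<nu> + real k + 1)) * (z / 2) powr (2 * real k + \<nu>))"

definition BK_char :: "real \<Rightarrow> real \<Rightarrow> real \<Rightarrow> complex" where
  "BK_char \<nu> l x =
     (if l * x = 0 then 1
      else complex_of_real (2 powr \<nu> * Gamma (\<nu> + 1) * Bessel_J \<nu> (l * x) * (l * x) powr (- \<nu>)))"

end

theory Submission
  imports Defs
begin

text \<open>
  Write \<open>\<alpha>\<^sub>\<lambda>(x) = g ((\<lambda>x)\<^sup>2)\<close> with \<open>g\<close> entire. Suppose \<open>\<lambda> > 0\<close> and let \<open>m\<close> be a mean for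
  \<open>\<alpha>\<^sub>\<lambda>\<close>. For \<open>\<mu> \<noteq> \<lambda>\<close> the product formula \<open>T\<^sub>x \<alpha>\<^sub>\<mu> = \<alpha>\<^sub>\<mu>(x) \<alpha>\<^sub>\<mu>\<close> gives
  \<open>\<alpha>\<^sub>\<mu>(x) m(\<alpha>\<^sub>\<mu>) = \<alpha>\<^sub>\<lambda>(x) m(\<alpha>\<^sub>\<mu>)\<close> for all \<open>x\<close>, so \<open>m(\<alpha>\<^sub>\<mu>) = 0\<close>. Since \<open>g\<close> vanishes at
  infinity, \<open>\<alpha>\<^sub>\<mu> \<rightarrow> \<alpha>\<^sub>\<lambda>\<close> uniformly as \<open>\<mu> \<rightarrow> \<lambda>\<close>; hence \<open>m(\<alpha>\<^sub>\<lambda>) = 0\<close>, a contradiction.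

  For \<open>\<lambda> = 0\<close> the intervals \<open>[0, R]\<close> form a Folner family: translation is self-adjoint for
  the Haar measure, so averages over \<open>[0, R]\<close> of \<open>T\<^sub>x f\<close> and \<open>f\<close> differ by at most the
  relative mass of \<open>[R - x, R + x]\<close>, and a cluster point of the averages is an invariant mean.
\<close>

section \<open>Bessel functions as entire functions of the square\<close>

text \<open>The variable s = (\<lambda>x)^2 makes the product formula elementary: the squared third
  side of a triangle with sides x and y is affine in cos \<theta>, so integrating a power series in
  it needs only the moments of the cosine, and comparing coefficients comes down to the
  Chu-Vandermonde identity. Decay of g at infinity is used twice, to separate the characters and to
  control the far range when two of them are compared uniformly. That comparison breaks down at
  \<lambda> = 0: each \<open>\<alpha>\<close> with positive parameter tends to 0, so its supremum
  distance from 1 is at least 1. Functions are total and bounded only almost everywhere, so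
  translation has to be compatible with null sets; self-adjointness provides this as well as the
  Folner estimate. The cluster point is taken in the product over all functions at once, since
  linearity needs one filter that serves every f. The boundary is negligible because [0, R] has mass
  proportional to R^(2\<nu>+2), which is only polynomial growth.\<close>

definition bessel_coeff :: "real \<Rightarrow> nat \<Rightarrow> real" where
  "bessel_coeff \<nu> k = (- 1 / 4) ^ k / (fact k * pochhammer (\<nu> + 1) k)"

text \<open>The hypergeometric function 0F1(; \<nu>+1; -s/4). Normalising J by
  \<open>Gamma (\<nu> + 1)\<close> is what turns its Gamma factors into Pochhammer symbols.\<close>

definition bessel_entire :: "real \<Rightarrow> real \<Rightarrow> real" where
  "bessel_entire \<nu> s = (\<Sum>k. bessel_coeff \<nu> k * s ^ k)"

lemma one_le_pochhammer:
  fixes a :: real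
  assumes "a \<ge> 1"
  shows "pochhammer a k \<ge> 1"
proof (induction k)
  case (Suc k)
  have "1 * 1 \<le> pochhammer a k * (a + real k)"
    using Suc assms by (intro mult_mono) auto
  then show ?case by (simp add: pochhammer_Suc)
qed simp

text \<open>Comparison with the exponential series: this bound gives convergence everywhere and
  later dominates the termwise integration in the product formula.\<close>

lemma abs_bessel_coeff_le:
  assumes "\<nu> \<ge> 0"
  shows "\<bar>bessel_coeff \<nu> k\<bar> \<le> 1 / fact k"
proof -
  have "\<bar>bessel_coeff \<nu> k\<bar> = (1 / 4) ^ k / (fact k * pochhammer (\<nu> + 1) k)"
    using one_le_pochhammer[of "\<nu> + 1" k] assms
    by (simp add: bessel_coeff_def abs_mult power_abs)
  also have "\<dots> \<le> 1 / (fact k * 1)"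
    using one_le_pochhammer[of "\<nu> + 1" k] assms
    by (intro frac_le mult_left_mono power_le_one) auto
  finally show ?thesis by simp
qed

lemma summable_norm_bessel_coeff:
  assumes "\<nu> \<ge> 0"
  shows "summable (\<lambda>k. norm (bessel_coeff \<nu> k * s ^ k))"
proof (rule summable_comparison_test')
  show "summable (\<lambda>k. inverse (fact k) * \<bar>s\<bar> ^ k)"
    by (rule summable_exp)
  show "norm (norm (bessel_coeff \<nu> k * s ^ k)) \<le> inverse (fact k) * \<bar>s\<bar> ^ k" for k
    using mult_right_mono[OF abs_bessel_coeff_le[OF assms, of k], of "\<bar>s\<bar> ^ k"]
    by (simp add: abs_mult power_abs divide_inverse)
qed

lemma summable_bessel_coeff:
  "\<nu> \<ge> 0 \<Longrightarrow> summable (\<lambda>k. bessel_coeff \<nu> k * s ^ k)"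
  by (rule summable_norm_cancel[OF summable_norm_bessel_coeff])

lemma bessel_entire_0 [simp]: "bessel_entire \<nu> 0 = 1"
proof -
  have "(\<Sum>k. bessel_coeff \<nu> k * 0 ^ k) = bessel_coeff \<nu> 0"
    by (rule powser_zero)
  then show ?thesis by (simp add: bessel_entire_def bessel_coeff_def)
qed

section \<open>Derivatives and Bessel's differential equation\<close>

definition bessel_entire' :: "real \<Rightarrow> real \<Rightarrow> real" where
  "bessel_entire' \<nu> s = (\<Sum>k. diffs (bessel_coeff \<nu>) k * s ^ k)"

definition bessel_entire'' :: "real \<Rightarrow> real \<Rightarrow> real" where
  "bessel_entire'' \<nu> s = (\<Sum>k. diffs (diffs (bessel_coeff \<nu>)) k * s ^ k)"

lemma summable_diffs_bessel_coeff:
  "\<nu> \<ge> 0 \<Longrightarrow> summable (\<lambda>k. diffs (bessel_coeff \<nu>) k * s ^ k)"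
  by (rule termdiff_converges_all[OF summable_bessel_coeff])

lemma bessel_entire_has_derivative:
  assumes "\<nu> \<ge> 0"
  shows "(bessel_entire \<nu> has_real_derivative bessel_entire' \<nu> s) (at s)"
  unfolding bessel_entire_def[abs_def] bessel_entire'_def
  by (rule termdiffs_strong_converges_everywhere[OF summable_bessel_coeff[OF assms]])

lemma bessel_entire'_has_derivative:
  assumes "\<nu> \<ge> 0"
  shows "(bessel_entire' \<nu> has_real_derivative bessel_entire'' \<nu> s) (at s)"
  unfolding bessel_entire'_def[abs_def] bessel_entire''_def
  by (rule termdiffs_strong_converges_everywhere[OF summable_diffs_bessel_coeff[OF assms]])

lemma continuous_on_bessel_entire:
  "\<nu> \<ge> 0 \<Longrightarrow> continuous_on A (bessel_entire \<nu>)"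
  by (intro continuous_at_imp_continuous_on ballI DERIV_isCont[OF bessel_entire_has_derivative])

lemma bessel_coeff_rec:
  assumes "\<nu> \<ge> 0"
  shows "(real k + 1) * (\<nu> + 1 + real k) * bessel_coeff \<nu> (Suc k) = - bessel_coeff \<nu> k / 4"
proof -
  have "pochhammer (\<nu> + 1) k \<noteq> 0" "\<nu> + 1 + real k \<noteq> 0" "real k + 1 \<noteq> 0"
    using one_le_pochhammer[of "\<nu> + 1" k] assms by auto
  then show ?thesis
    by (simp add: bessel_coeff_def pochhammer_Suc add.commute)
qed

text \<open>With f z = g (z^2), this is the equation f'' + (2\<nu>+1)/z f' + f = 0 of the normalised
  Bessel function, rewritten in s = z^2; \<open>bessel_coeff_rec\<close> is its coefficientwise
  form.\<close>

lemma bessel_entire_ode: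
  assumes "\<nu> \<ge> 0"
  shows "s * bessel_entire'' \<nu> s + (\<nu> + 1) * bessel_entire' \<nu> s + bessel_entire \<nu> s / 4 = 0"
proof -
  let ?c = "bessel_coeff \<nu>"
  have 1: "summable (\<lambda>k. diffs (diffs ?c) k * s ^ k)"
    by (rule termdiff_converges_all[OF summable_diffs_bessel_coeff[OF assms]])
  have "(\<lambda>k. real k * diffs ?c k * s ^ (k - Suc 0)) sums bessel_entire'' \<nu> s"
    using diffs_equiv[OF 1] by (simp add: bessel_entire''_def)
  then have "(\<lambda>k. s * (real k * diffs ?c k * s ^ (k - Suc 0))) sums (s * bessel_entire'' \<nu> s)"
    by (rule sums_mult)
  \<comment> \<open>The factor s restores the lowered exponent; at k = 0, where the exponent is
    truncated, the factor \<open>real k\<close> is 0.\<close>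
  moreover have "s * (real k * diffs ?c k * s ^ (k - Suc 0)) = real k * diffs ?c k * s ^ k" for k
    by (cases k) auto
  ultimately have A: "(\<lambda>k. real k * diffs ?c k * s ^ k) sums (s * bessel_entire'' \<nu> s)"
    by simp
  have B: "(\<lambda>k. (\<nu> + 1) * (diffs ?c k * s ^ k)) sums ((\<nu> + 1) * bessel_entire' \<nu> s)"
    unfolding bessel_entire'_def
    by (intro sums_mult summable_sums summable_diffs_bessel_coeff assms)
  have C: "(\<lambda>k. ?c k * s ^ k / 4) sums (bessel_entire \<nu> s / 4)"
    unfolding bessel_entire_def
    by (intro sums_divide summable_sums summable_bessel_coeff assms)
  have "real k * diffs ?c k * s ^ k + (\<nu> + 1) * (diffs ?c k * s ^ k) + ?c k * s ^ k / 4 = 0" for k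
  proof -
    have "real k * diffs ?c k * s ^ k + (\<nu> + 1) * (diffs ?c k * s ^ k) + ?c k * s ^ k / 4
        = ((real k + 1) * (\<nu> + 1 + real k) * ?c (Suc k) + ?c k / 4) * s ^ k"
      by (simp add: diffs_def algebra_simps add_divide_distrib)
    then show ?thesis by (simp add: bessel_coeff_rec[OF assms])
  qed
  with sums_add[OF sums_add[OF A B] C] show ?thesis
    by (simp add: sums_iff)
qed

text \<open>The function \<open>u z = z powr (\<nu> + 1/2) * g (z\<^sup>2)\<close> satisfies
  \<open>u'' + (1 - (\<nu>\<^sup>2 - 1/4) / z\<^sup>2) u = 0\<close>; its energy \<open>u\<^sup>2 + u'\<^sup>2\<close> stays bounded,
  because \<open>1 / z\<^sup>2\<close> is integrable at infinity.\<close>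

lemma bessel_entire_bound:
  assumes \<nu>: "\<nu> \<ge> 0"
  obtains B where "\<And>z. z \<ge> 1 \<Longrightarrow> z powr (2 * \<nu> + 1) * (bessel_entire \<nu> (z\<^sup>2))\<^sup>2 \<le> B"
proof -
  let ?p = "\<nu> + 1 / 2"
  \<comment> \<open>p (p - 1) = \<nu>^2 - 1/4 is the coefficient of the perturbation of u'' + u =
    0.\<close>
  define C where "C = \<bar>?p * (?p - 1)\<bar>"
  define u where "u = (\<lambda>z. z powr ?p * bessel_entire \<nu> (z\<^sup>2))"
  define v where "v = (\<lambda>z. ?p * z powr (?p - 1) * bessel_entire \<nu> (z\<^sup>2)
    + z powr ?p * (2 * z * bessel_entire' \<nu> (z\<^sup>2)))"
  have du: "(u has_real_derivative v z) (at z)" if "z > 0" for z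
    unfolding u_def v_def using that
    by (auto intro!: derivative_eq_intros DERIV_chain2[OF bessel_entire_has_derivative[OF \<nu>]])
  have dv: "(v has_real_derivative (?p * (?p - 1) / z\<^sup>2 - 1) * u z) (at z)" if z: "z > 0" for z
  proof -
    have p1: "z powr (?p - 1) = z powr ?p / z" "z powr (?p - 1 - 1) = z powr ?p / z / z"
      using z powr_diff[of z ?p 1] powr_diff[of z "?p - 1" 1] by auto
    have ode: "4 * z\<^sup>2 * bessel_entire'' \<nu> (z\<^sup>2) =
        - (4 * (\<nu> + 1) * bessel_entire' \<nu> (z\<^sup>2)) - bessel_entire \<nu> (z\<^sup>2)"
      using bessel_entire_ode[OF \<nu>, of "z\<^sup>2"] by (simp add: field_simps)
    have "(v has_real_derivative
       (?p * ((?p - 1) * z powr (?p - 1 - 1)) * bessel_entire \<nu> (z\<^sup>2)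
        + ?p * z powr (?p - 1) * (bessel_entire' \<nu> (z\<^sup>2) * (2 * z))
        + (?p * z powr (?p - 1) * (2 * z * bessel_entire' \<nu> (z\<^sup>2))
        + z powr ?p * (2 * bessel_entire' \<nu> (z\<^sup>2) + 2 * z * (bessel_entire'' \<nu> (z\<^sup>2) * (2 * z)))))) (at z)"
      unfolding v_def using z
      by (auto intro!: derivative_eq_intros DERIV_chain2[OF bessel_entire_has_derivative[OF \<nu>]]
          DERIV_chain2[OF bessel_entire'_has_derivative[OF \<nu>]])
    also have "?p * ((?p - 1) * z powr (?p - 1 - 1)) * bessel_entire \<nu> (z\<^sup>2)
        + ?p * z powr (?p - 1) * (bessel_entire' \<nu> (z\<^sup>2) * (2 * z))
        + (?p * z powr (?p - 1) * (2 * z * bessel_entire' \<nu> (z\<^sup>2))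
        + z powr ?p * (2 * bessel_entire' \<nu> (z\<^sup>2) + 2 * z * (bessel_entire'' \<nu> (z\<^sup>2) * (2 * z))))
      = z powr ?p * (?p * (?p - 1) / z\<^sup>2 * bessel_entire \<nu> (z\<^sup>2)
          + (4 * ?p + 2) * bessel_entire' \<nu> (z\<^sup>2) + 4 * z\<^sup>2 * bessel_entire'' \<nu> (z\<^sup>2))"
      unfolding p1 using z by (simp add: divide_simps power2_eq_square) (simp add: algebra_simps)
    \<comment> \<open>Since 4p + 2 = 4(\<nu>+1), the differential equation absorbs the first-order
      term together with the second-order one; this is why the exponent is \<nu> + 1/2.\<close>
    also have "\<dots> = (?p * (?p - 1) / z\<^sup>2 - 1) * u z"
      unfolding ode u_def using z by (simp add: algebra_simps)
    finally show ?thesis .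
  qed
  \<comment> \<open>Here v = u', and the derivative of u^2 + v^2 is at most C (u^2 + v^2) / z^2. The
    factor exp(C/z) has logarithmic derivative -C/z^2, so E is nonincreasing; being at least 1, it
    keeps E above the energy.\<close>
  define E where "E = (\<lambda>z. ((u z)\<^sup>2 + (v z)\<^sup>2) * exp (C / z))"
  have dE: "\<exists>y. (E has_real_derivative y) (at z) \<and> y \<le> 0" if z: "1 \<le> z" for z
  proof (intro exI conjI)
    have z0: "z > 0" using z by simp
    show "(E has_real_derivative
       (2 * u z * v z + 2 * v z * ((?p * (?p - 1) / z\<^sup>2 - 1) * u z)) * exp (C / z)
        + ((u z)\<^sup>2 + (v z)\<^sup>2) * (exp (C / z) * (- (C / z\<^sup>2)))) (at z)"
      unfolding E_def using z0
      by (auto intro!: derivative_eq_intros du dv simp: power2_eq_square divide_simps)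
        (simp add: algebra_simps)?
    have "2 * u z * v z + 2 * v z * ((?p * (?p - 1) / z\<^sup>2 - 1) * u z)
        = (?p * (?p - 1)) * (2 * u z * v z) / z\<^sup>2"
      by (simp add: algebra_simps)
    also have "(?p * (?p - 1)) * (2 * u z * v z) \<le> C * ((u z)\<^sup>2 + (v z)\<^sup>2)"
    proof -
      have "\<bar>2 * u z * v z\<bar> \<le> (u z)\<^sup>2 + (v z)\<^sup>2"
        using zero_le_power2[of "u z - v z"] zero_le_power2[of "u z + v z"]
        by (simp add: abs_le_iff power2_eq_square algebra_simps)
      then have "\<bar>(?p * (?p - 1)) * (2 * u z * v z)\<bar> \<le> C * ((u z)\<^sup>2 + (v z)\<^sup>2)"
        unfolding C_def abs_mult[of "?p * (?p - 1)"] by (rule mult_left_mono) simp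
      then show ?thesis by simp
    qed
    finally have "2 * u z * v z + 2 * v z * ((?p * (?p - 1) / z\<^sup>2 - 1) * u z)
        \<le> C * ((u z)\<^sup>2 + (v z)\<^sup>2) / z\<^sup>2"
      by (simp add: divide_right_mono)
    from mult_right_mono[OF this, of "exp (C / z)"]
    show "(2 * u z * v z + 2 * v z * ((?p * (?p - 1) / z\<^sup>2 - 1) * u z)) * exp (C / z)
        + ((u z)\<^sup>2 + (v z)\<^sup>2) * (exp (C / z) * (- (C / z\<^sup>2))) \<le> 0"
      by (simp add: algebra_simps add_divide_distrib)
  qed
  have "z powr (2 * \<nu> + 1) * (bessel_entire \<nu> (z\<^sup>2))\<^sup>2 \<le> E 1" if z: "z \<ge> 1" for z
  proof -
    have "z powr (2 * \<nu> + 1) * (bessel_entire \<nu> (z\<^sup>2))\<^sup>2 = (u z)\<^sup>2"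
      by (simp add: u_def power_mult_distrib power2_eq_square flip: powr_add)
    also have "\<dots> \<le> ((u z)\<^sup>2 + (v z)\<^sup>2) * 1" by simp
    also have "\<dots> \<le> E z"
      unfolding E_def using z by (intro mult_left_mono) (auto simp: C_def)
    also have "E z \<le> E 1"
      using z dE by (intro DERIV_nonpos_imp_nonincreasing[of 1 z E]) auto
    finally show ?thesis .
  qed
  then show thesis by (rule that)
qed

text \<open>The energy bound forces decay at least of order z^(-(\<nu>+1/2)), and this exponent is
  still negative at \<nu> = 0.\<close>

lemma bessel_entire_square_tendsto_0:
  assumes \<nu>: "\<nu> \<ge> 0"
  shows "((\<lambda>z. bessel_entire \<nu> (z\<^sup>2)) \<longlongrightarrow> 0) at_top"
proof -
  obtain B where B: "\<And>z. z \<ge> 1 \<Longrightarrow> z powr (2 * \<nu> + 1) * (bessel_entire \<nu> (z\<^sup>2))\<^sup>2 \<le> B"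
    using bessel_entire_bound[OF \<nu>] by blast
  have "((\<lambda>z. (bessel_entire \<nu> (z\<^sup>2))\<^sup>2) \<longlongrightarrow> 0) at_top"
  proof (rule tendsto_sandwich[of "\<lambda>_. 0"])
    show "\<forall>\<^sub>F z in at_top. (bessel_entire \<nu> (z\<^sup>2))\<^sup>2 \<le> B / z powr (2 * \<nu> + 1)"
      using eventually_ge_at_top[of 1]
    proof eventually_elim
      case (elim z)
      then show ?case using B[of z] by (simp add: field_simps)
    qed
    have "((\<lambda>z. B * z powr (- (2 * \<nu> + 1))) \<longlongrightarrow> B * 0) at_top"
      using \<nu> by (intro tendsto_intros tendsto_neg_powr filterlim_ident) auto
    then show "((\<lambda>z. B / z powr (2 * \<nu> + 1)) \<longlongrightarrow> 0) at_top"
      by (simp only: powr_minus divide_inverse mult_zero_right)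
  qed simp_all
  from tendsto_real_sqrt[OF this] show ?thesis
    by (simp add: tendsto_rabs_zero_iff)
qed

section \<open>The angular measure and its cosine moments\<close>

definition angle_const :: "real \<Rightarrow> real" where
  "angle_const \<nu> = Gamma (\<nu> + 1) / (Gamma (1 / 2) * Gamma (\<nu> + 1 / 2))"

definition angle_measure :: "real \<Rightarrow> real measure" where
  "angle_measure \<nu> = density (restrict_space lborel {0..pi})
     (\<lambda>\<theta>. ennreal (angle_const \<nu> * sin \<theta> powr (2 * \<nu>)))"

lemma angle_const_pos: "\<nu> \<ge> 0 \<Longrightarrow> angle_const \<nu> > 0"
  by (auto simp: angle_const_def intro!: divide_pos_pos mult_pos_pos Gamma_real_pos)

lemma space_angle_measure [simp]: "space (angle_measure \<nu>) = {0..pi}"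
  by (simp add: angle_measure_def space_restrict_space)

lemma sets_angle_measure [measurable_cong]: "sets (angle_measure \<nu>) = sets (restrict_space borel {0..pi})"
  by (simp add: angle_measure_def sets_restrict_space)

section \<open>Normalisation of the angular measure\<close>

lemma Gamma_legendre_duplication_real:
  fixes x :: real
  assumes "x > 0"
  shows "Gamma x * Gamma (x + 1 / 2) = 2 powr (1 - 2 * x) * sqrt pi * Gamma (2 * x)"
proof -
  have "complex_of_real x \<notin> \<int>\<^sub>\<le>\<^sub>0" "complex_of_real x + 1 / 2 \<notin> \<int>\<^sub>\<le>\<^sub>0"
    using assms by (auto elim!: nonpos_Ints_cases simp: complex_eq_iff)
  from Gamma_legendre_duplication[OF this]
  have "complex_of_real (Gamma x * Gamma (x + 1 / 2)) =
      complex_of_real (exp ((1 - 2 * x) * ln 2) * sqrt pi * Gamma (2 * x))"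
    by (simp flip: Gamma_complex_of_real exp_of_real)
  then show ?thesis
    by (simp only: of_real_eq_iff powr_def) (simp add: mult.commute)
qed

text \<open>The substitution t = (1 - cos \<theta>)/2, for which sin^2 \<theta> = 4t(1 - t), turns
  this into Euler's Beta integral.\<close>

lemma nn_integral_sin_powr:
  assumes "\<nu> > - (1 / 2)"
  shows "(\<integral>\<^sup>+\<theta>. ennreal (sin \<theta> powr (2 * \<nu>) * indicator {0..pi} \<theta>) \<partial>lborel)
    = ennreal (2 powr (2 * \<nu>) * Beta (\<nu> + 1 / 2) (\<nu> + 1 / 2))"
proof -
  let ?a = "\<nu> + 1 / 2"
  let ?f = "\<lambda>t::real. t powr (?a - 1) * (1 - t) powr (?a - 1)"
  let ?g = "\<lambda>\<theta>::real. (1 - cos \<theta>) / 2"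
  have "(\<integral>\<^sup>+t. ennreal (2 powr (2 * \<nu>) * ?f t * indicator {?g 0..?g pi} t) \<partial>lborel)
      = (\<integral>\<^sup>+\<theta>. ennreal (2 powr (2 * \<nu>) * ?f (?g \<theta>) * (sin \<theta> / 2) * indicator {0..pi} \<theta>) \<partial>lborel)"
    by (rule nn_integral_substitution)
      (auto intro!: derivative_eq_intros continuous_intros sin_ge_zero simp: set_borel_measurable_def)
  also have "\<dots> = (\<integral>\<^sup>+\<theta>. ennreal (sin \<theta> powr (2 * \<nu>) * indicator {0..pi} \<theta>) \<partial>lborel)"
  proof (intro nn_integral_cong arg_cong[where f = ennreal])
    fix \<theta> :: real
    show "2 powr (2 * \<nu>) * ?f (?g \<theta>) * (sin \<theta> / 2) * indicator {0..pi} \<theta>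
        = sin \<theta> powr (2 * \<nu>) * indicator {0..pi} \<theta>"
    \<comment> \<open>Where the sine vanishes both sides are 0, because 0 powr a = 0 for every a,
      including a = 0.\<close>
    proof (cases "\<theta> \<in> {0..pi} \<and> sin \<theta> \<noteq> 0")
      case True
      then have s: "sin \<theta> > 0" using sin_ge_zero[of \<theta>] by auto
      have "?f (?g \<theta>) = (?g \<theta> * (1 - ?g \<theta>)) powr (?a - 1)"
        by (rule powr_mult[symmetric])
      also have "?g \<theta> * (1 - ?g \<theta>) = (sin \<theta> / 2)\<^sup>2"
        unfolding power_divide sin_squared_eq by (simp add: field_simps power2_eq_square)
      also have "(sin \<theta> / 2)\<^sup>2 powr (?a - 1) = (sin \<theta> / 2) powr (2 * \<nu> - 1)"
        using s by (simp add: powr_powr powr_numeral[symmetric] algebra_simps del: powr_numeral)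
      finally have f: "?f (?g \<theta>) = (sin \<theta> / 2) powr (2 * \<nu> - 1)" .
      have "2 powr (2 * \<nu>) * ((sin \<theta> / 2) powr (2 * \<nu> - 1) * (sin \<theta> / 2)) = sin \<theta> powr (2 * \<nu>)"
        using s by (simp add: powr_diff powr_divide)
      then show ?thesis
        unfolding f using True by (simp add: mult.assoc)
    qed auto
  qed
  finally have "(\<integral>\<^sup>+\<theta>. ennreal (sin \<theta> powr (2 * \<nu>) * indicator {0..pi} \<theta>) \<partial>lborel)
      = (\<integral>\<^sup>+t. ennreal (2 powr (2 * \<nu>) * ?f t * indicator {?g 0..?g pi} t) \<partial>lborel)"
    by (rule sym)
  also have "\<dots> = (\<integral>\<^sup>+t\<in>{0..1}. ennreal (2 powr (2 * \<nu>) * ?f t) \<partial>lborel)"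
    by (intro nn_integral_cong) (auto split: split_indicator)
  also have "\<dots> = ennreal (2 powr (2 * \<nu>) * Beta ?a ?a)"
    using assms by (intro nn_integral_has_integral_lebesgue' has_integral_mult_right has_integral_Beta_real) auto
  finally show ?thesis .
qed

text \<open>The total mass is \<open>angle_const\<close> times a power of 2 and a Beta value;
  Legendre's duplication formula at \<nu> + 1/2 says that this is 1.\<close>

lemma prob_space_angle_measure:
  assumes \<nu>: "\<nu> \<ge> 0"
  shows "prob_space (angle_measure \<nu>)"
proof (rule prob_spaceI)
  have "emeasure (angle_measure \<nu>) (space (angle_measure \<nu>))
      = (\<integral>\<^sup>+\<theta>\<in>{0..pi}. ennreal (angle_const \<nu> * sin \<theta> powr (2 * \<nu>)) \<partial>restrict_space lborel {0..pi})"
    unfolding space_angle_measure unfolding angle_measure_def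
    by (rule emeasure_density) (auto simp: sets_restrict_space_iff intro!: measurable_restrict_space1)
  also have "\<dots> = (\<integral>\<^sup>+\<theta>. ennreal (angle_const \<nu>) * ennreal (sin \<theta> powr (2 * \<nu>) * indicator {0..pi} \<theta>) \<partial>lborel)"
    using angle_const_pos[OF \<nu>]
    by (subst nn_integral_restrict_space)
      (auto intro!: nn_integral_cong simp: ennreal_mult split: split_indicator)
  also have "\<dots> = ennreal (angle_const \<nu> * (2 powr (2 * \<nu>) * Beta (\<nu> + 1 / 2) (\<nu> + 1 / 2)))"
    using nn_integral_sin_powr[of \<nu>] \<nu> angle_const_pos[OF \<nu>]
    by (simp add: nn_integral_cmult ennreal_mult')
  also have "angle_const \<nu> * (2 powr (2 * \<nu>) * Beta (\<nu> + 1 / 2) (\<nu> + 1 / 2)) = 1"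
  proof -
    have dup: "2 powr (2 * \<nu>) * (Gamma (\<nu> + 1 / 2) * Gamma (\<nu> + 1)) = sqrt pi * Gamma (2 * \<nu> + 1)"
      using Gamma_legendre_duplication_real[of "\<nu> + 1 / 2"] \<nu>
      by (simp add: algebra_simps powr_minus powr_diff)
    have pos: "Gamma (2 * \<nu> + 1) > 0" "Gamma (\<nu> + 1 / 2) > 0"
      using \<nu> by (auto intro!: Gamma_real_pos)
    have arg: "\<nu> + 1 / 2 + (\<nu> + 1 / 2) = 2 * \<nu> + 1" by simp
    have cancel: "B / (s * A) * (t * (A * A / G)) = (t * (A * B)) / (s * G)"
      if "A > 0" "G > 0" "s > 0" for A B G s t :: real
      using that by (simp add: field_simps)
    have "sqrt pi > 0" by simp
    then show ?thesis
      unfolding angle_const_def Beta_def Gamma_one_half_real arg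
      using pos by (subst cancel) (auto simp: dup)
  qed
  finally show "emeasure (angle_measure \<nu>) (space (angle_measure \<nu>)) = 1" by simp
qed

lemma integrable_angle_measure:
  fixes f :: "real \<Rightarrow> real"
  assumes "\<nu> \<ge> 0" and "f \<in> borel_measurable borel" and "\<And>\<theta>. \<bar>f \<theta>\<bar> \<le> B"
  shows "integrable (angle_measure \<nu>) f"
proof -
  interpret prob_space "angle_measure \<nu>" by (rule prob_space_angle_measure) fact
  have "f \<in> borel_measurable (angle_measure \<nu>)"
    using assms(2) by (simp add: measurable_cong_sets[OF sets_angle_measure refl] measurable_restrict_space1)
  then show ?thesis
    using assms(3) by (intro integrable_const_bound[of _ B]) auto
qed

text \<open>A passage to the gauge integral, whose fundamental theorem of calculus asks for
  derivatives in the interior only.\<close>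

lemma has_integral_angle_measure:
  fixes f :: "real \<Rightarrow> real"
  assumes \<nu>: "\<nu> \<ge> 0" and f: "f \<in> borel_measurable borel" and B: "\<And>\<theta>. \<bar>f \<theta>\<bar> \<le> B"
  shows "((\<lambda>\<theta>. angle_const \<nu> * sin \<theta> powr (2 * \<nu>) * f \<theta>) has_integral
    (\<integral>\<theta>. f \<theta> \<partial>angle_measure \<nu>)) {0..pi}"
proof -
  let ?R = "restrict_space lborel {0..pi}"
  let ?w = "\<lambda>\<theta>. angle_const \<nu> * sin \<theta> powr (2 * \<nu>)"
  have m: "f \<in> borel_measurable ?R" "?w \<in> borel_measurable ?R"
    using f by (auto intro!: measurable_restrict_space1)
  have w: "AE \<theta> in ?R. 0 \<le> ?w \<theta>"
    using angle_const_pos[OF \<nu>] by auto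
  have "integrable ?R (\<lambda>\<theta>. ?w \<theta> *\<^sub>R f \<theta>)"
    using integrable_angle_measure[OF assms] integrable_density[OF m w] by (simp add: angle_measure_def)
  then have i: "set_integrable lborel {0..pi} (\<lambda>\<theta>. ?w \<theta> * f \<theta>)"
    by (simp add: set_integrable_def integrable_restrict_space)
  have "(\<integral>\<theta>. f \<theta> \<partial>angle_measure \<nu>) = (\<integral>\<theta>. ?w \<theta> *\<^sub>R f \<theta> \<partial>?R)"
    unfolding angle_measure_def by (rule integral_density[OF m w])
  also have "\<dots> = (LINT \<theta>:{0..pi}|lborel. ?w \<theta> * f \<theta>)"
    by (simp add: set_lebesgue_integral_def integral_restrict_space)
  finally show ?thesis
    using set_borel_integral_eq_integral[OF i] by (simp add: has_integral_integrable_integral)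
qed

section \<open>Moments of the cosine\<close>

definition cos_moment :: "real \<Rightarrow> nat \<Rightarrow> real" where
  "cos_moment \<nu> j = (\<integral>\<theta>. cos \<theta> ^ j \<partial>angle_measure \<nu>)"

lemma abs_cos_power_le: "\<bar>cos (\<theta>::real) ^ j\<bar> \<le> 1"
  by (simp add: power_abs power_le_one)

lemma cos_moment_0 [simp]: "\<nu> \<ge> 0 \<Longrightarrow> cos_moment \<nu> 0 = 1"
  using prob_space.prob_space[OF prob_space_angle_measure] by (simp add: cos_moment_def)

text \<open>Integrating the derivative of \<open>cos \<theta> ^ (j - 1) * sin \<theta> powr (2 * \<nu> + 1)\<close>.\<close>

lemma cos_moment_rec:
  assumes \<nu>: "\<nu> \<ge> 0" and j: "j \<ge> 1"
  shows "(2 * \<nu> + real j) * cos_moment \<nu> j = (real j - 1) * cos_moment \<nu> (j - 2)"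
proof -
  let ?w = "\<lambda>\<theta>. angle_const \<nu> * sin \<theta> powr (2 * \<nu>)"
  let ?F = "\<lambda>\<theta>. angle_const \<nu> * (cos \<theta> ^ (j - 1) * sin \<theta> powr (2 * \<nu> + 1))"
  let ?d = "\<lambda>\<theta>. (2 * \<nu> + real j) * (?w \<theta> * cos \<theta> ^ j) - (real j - 1) * (?w \<theta> * cos \<theta> ^ (j - 2))"
  have "(?d has_integral ?F pi - ?F 0) {0..pi}"
  \<comment> \<open>The derivative of the real power is taken only where the sine is positive;
    continuity up to the end points holds because 2\<nu> + 1 > 0.\<close>
  proof (rule fundamental_theorem_of_calculus_interior)
    show "continuous_on {0..pi} ?F"
      using \<nu> by (intro continuous_intros continuous_on_powr') (auto intro: sin_ge_zero)
    fix \<theta> :: real assume "\<theta> \<in> {0<..<pi}"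
    then have s: "sin \<theta> > 0" by (auto intro: sin_gt_zero)
    have "(?F has_real_derivative
        angle_const \<nu> * (real (j - 1) * cos \<theta> ^ (j - 1 - 1) * (- sin \<theta>) * sin \<theta> powr (2 * \<nu> + 1)
         + cos \<theta> ^ (j - 1) * ((2 * \<nu> + 1) * sin \<theta> powr (2 * \<nu>) * cos \<theta>))) (at \<theta>)"
      using s by (auto intro!: derivative_eq_intros simp: mult_ac)
    also have "angle_const \<nu> * (real (j - 1) * cos \<theta> ^ (j - 1 - 1) * (- sin \<theta>) * sin \<theta> powr (2 * \<nu> + 1)
         + cos \<theta> ^ (j - 1) * ((2 * \<nu> + 1) * sin \<theta> powr (2 * \<nu>) * cos \<theta>))
        = ?w \<theta> * ((2 * \<nu> + 1) * (cos \<theta> * cos \<theta> ^ (j - 1)) - real (j - 1) * cos \<theta> ^ (j - 2) * (sin \<theta>)\<^sup>2)"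
      using s by (simp add: powr_add algebra_simps power2_eq_square numeral_2_eq_2)
    also have "cos \<theta> * cos \<theta> ^ (j - 1) = cos \<theta> ^ j"
      using j by (cases j) auto
    also have "real (j - 1) * cos \<theta> ^ (j - 2) * (sin \<theta>)\<^sup>2
        = (real j - 1) * (cos \<theta> ^ (j - 2) - cos \<theta> ^ j)"
    \<comment> \<open>For j = 1 the exponent j - 2 is truncated to 0, but its coefficient j - 1 is
      0.\<close>
    proof (cases "j = 1")
      case False
      with j have "2 \<le> j" by simp
      then obtain i where i: "j = Suc (Suc i)" by (metis add_2_eq_Suc le_Suc_ex)
      have "real (Suc i) * c ^ i * (1 - c\<^sup>2) = real (Suc i) * (c ^ i - c ^ Suc (Suc i))" for c :: real
      proof -
        have "c ^ Suc (Suc i) = c ^ i * c\<^sup>2" by (simp add: power2_eq_square)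
        then show ?thesis by (simp only: mult.assoc right_diff_distrib mult_1_right)
      qed
      from this[of "cos \<theta>"] show ?thesis
        by (simp only: i sin_squared_eq) simp
    qed auto
    finally show "(?F has_vector_derivative ?d \<theta>) (at \<theta>)"
      by (simp add: has_real_derivative_iff_has_vector_derivative algebra_simps)
  qed simp
  moreover have "?F pi - ?F 0 = 0" by simp
  ultimately have 1: "(?d has_integral 0) {0..pi}" by (simp only:)
  have "(?d has_integral (2 * \<nu> + real j) * cos_moment \<nu> j - (real j - 1) * cos_moment \<nu> (j - 2)) {0..pi}"
    unfolding cos_moment_def
    by (intro has_integral_diff has_integral_mult_right has_integral_angle_measure[OF \<nu>, where B = 1]
        abs_cos_power_le) auto
  from has_integral_unique[OF 1 this] show ?thesis by simp
qed

lemma cos_moment_odd: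
  assumes \<nu>: "\<nu> \<ge> 0"
  shows "cos_moment \<nu> (Suc (2 * i)) = 0"
proof (induction i)
  case 0
  then show ?case using cos_moment_rec[OF \<nu>, of 1] \<nu> by auto
next
  case (Suc i)
  have "Suc (2 * Suc i) - 2 = Suc (2 * i)" by simp
  then show ?case using cos_moment_rec[OF \<nu>, of "Suc (2 * Suc i)"] \<nu> Suc
    by (simp del: mult_Suc_right)
qed

lemma cos_moment_even:
  assumes \<nu>: "\<nu> \<ge> 0"
  shows "cos_moment \<nu> (2 * i) = pochhammer (1 / 2) i / pochhammer (\<nu> + 1) i"
proof (induction i)
  case (Suc i)
  have 1: "2 * Suc i - 2 = 2 * i" by simp
  have "(2 * \<nu> + 2 * real i + 2) * cos_moment \<nu> (2 * Suc i) = (2 * real i + 1) * cos_moment \<nu> (2 * i)"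
    using cos_moment_rec[OF \<nu>, of "2 * Suc i"] unfolding 1 by (simp add: algebra_simps)
  moreover have "\<nu> + 1 + real i \<noteq> 0" using \<nu> by linarith
  ultimately have "cos_moment \<nu> (2 * Suc i) = (1 / 2 + real i) / (\<nu> + 1 + real i) * cos_moment \<nu> (2 * i)"
    by (simp add: field_simps)
  also have "\<dots> = pochhammer (1 / 2) (Suc i) / pochhammer (\<nu> + 1) (Suc i)"
    unfolding Suc.IH pochhammer_Suc by (simp add: mult.commute)
  finally show ?case .
qed (use \<nu> in simp)

section \<open>The product formula\<close>

text \<open>After multiplication by m! (\<nu>+1)_n each summand is a product of generalised
  binomials, (m choose i) (\<nu>+n choose n-i), and Chu-Vandermonde sums them to (m+\<nu>+n choose
  n). This is the identity that closes the coefficient comparison for x^(2m) y^(2n).\<close>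

lemma bessel_vandermonde:
  fixes \<nu> :: real
  assumes \<nu>: "\<nu> \<ge> 0"
  shows "(\<Sum>i\<le>n. if i \<le> m then 1 / (fact i * fact (m - i) * fact (n - i) * pochhammer (\<nu> + 1) i) else 0)
    = pochhammer (\<nu> + 1) (m + n) /
      (fact m * fact n * pochhammer (\<nu> + 1) m * pochhammer (\<nu> + 1) n)"
proof -
  have p: "pochhammer (\<nu> + 1) i > 0" for i
    using one_le_pochhammer[of "\<nu> + 1" i] \<nu> by simp
  have t: "(real m gchoose i) * ((\<nu> + real n) gchoose (n - i)) =
      (fact m * pochhammer (\<nu> + 1) n) *
      (if i \<le> m then 1 / (fact i * fact (m - i) * fact (n - i) * pochhammer (\<nu> + 1) i) else 0)"
    if "i \<le> n" for i
  proof (cases "i \<le> m")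
    case True
    have "\<nu> + real n - real (n - i) + 1 = \<nu> + 1 + real i"
      using that by (simp add: of_nat_diff)
    then have "(\<nu> + real n) gchoose (n - i) = pochhammer (\<nu> + 1 + real i) (n - i) / fact (n - i)"
      by (simp add: gbinomial_pochhammer' add_ac)
    also have "\<dots> = pochhammer (\<nu> + 1) n / (pochhammer (\<nu> + 1) i * fact (n - i))"
      using pochhammer_product[OF that, of "\<nu> + 1"] p[of i] by simp
    finally show ?thesis
      using True by (simp add: binomial_fact flip: binomial_gbinomial)
  next
    case False
    then show ?thesis by (simp flip: binomial_gbinomial)
  qed
  have "(fact m * pochhammer (\<nu> + 1) n) *
      (\<Sum>i\<le>n. if i \<le> m then 1 / (fact i * fact (m - i) * fact (n - i) * pochhammer (\<nu> + 1) i) else 0)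
    = (\<Sum>i\<le>n. (real m gchoose i) * ((\<nu> + real n) gchoose (n - i)))"
    unfolding sum_distrib_left by (rule sum.cong) (auto simp: t)
  also have "\<dots> = (real m + (\<nu> + real n)) gchoose n"
    unfolding atMost_atLeast0 by (rule gbinomial_Vandermonde)
  also have "\<dots> = pochhammer (\<nu> + 1 + real m) n / fact n"
    by (simp add: gbinomial_pochhammer' add_ac)
  also have "\<dots> = pochhammer (\<nu> + 1) (m + n) / (pochhammer (\<nu> + 1) m * fact n)"
    using p[of m] by (simp add: pochhammer_product')
  finally have "(fact m * pochhammer (\<nu> + 1) n) *
      (\<Sum>i\<le>n. if i \<le> m then 1 / (fact i * fact (m - i) * fact (n - i) * pochhammer (\<nu> + 1) i) else 0)
    = pochhammer (\<nu> + 1) (m + n) / (pochhammer (\<nu> + 1) m * fact n)" .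
  from arg_cong[OF this, of "\<lambda>t. t / (fact m * pochhammer (\<nu> + 1) n)"] show ?thesis
    using p[of n] by (simp add: mult_ac)
qed

text \<open>A binomial expansion in the cross term 2xy cos \<theta> leaves only even moments;
  regrouping by powers of x^2 produces the sum of \<open>bessel_vandermonde\<close>. The shape is
  chosen so that multiplication by \<open>bessel_coeff \<nu> k\<close> gives the k-th term of a
  Cauchy product.\<close>

lemma integral_angle_power:
  assumes \<nu>: "\<nu> \<ge> 0"
  shows "(\<integral>\<theta>. (x\<^sup>2 + y\<^sup>2 - 2 * x * y * cos \<theta>) ^ k \<partial>angle_measure \<nu>)
    = (\<Sum>m\<le>k. fact k * pochhammer (\<nu> + 1) k /
        (fact m * fact (k - m) * pochhammer (\<nu> + 1) m * pochhammer (\<nu> + 1) (k - m)) *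
        ((x\<^sup>2) ^ m * (y\<^sup>2) ^ (k - m)))"
proof -
  define S where "S = x\<^sup>2 + y\<^sup>2"
  define T where "T = 2 * x * y"
  have T2: "T ^ (2 * i) = 4 ^ i * ((x\<^sup>2) ^ i * (y\<^sup>2) ^ i)" for i
    by (simp add: T_def power_mult power_mult_distrib)
  have "(\<integral>\<theta>. (x\<^sup>2 + y\<^sup>2 - 2 * x * y * cos \<theta>) ^ k \<partial>angle_measure \<nu>)
      = (\<integral>\<theta>. (\<Sum>j\<le>k. (real (k choose j) * (- T) ^ j * S ^ (k - j)) * cos \<theta> ^ j) \<partial>angle_measure \<nu>)"
  proof (intro Bochner_Integration.integral_cong refl)
    fix \<theta>
    have "(x\<^sup>2 + y\<^sup>2 - 2 * x * y * cos \<theta>) ^ k = ((- T * cos \<theta>) + S) ^ k"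
      by (simp add: S_def T_def algebra_simps)
    also have "\<dots> = (\<Sum>j\<le>k. (real (k choose j) * (- T) ^ j * S ^ (k - j)) * cos \<theta> ^ j)"
      unfolding binomial_ring by (intro sum.cong refl) (simp only: power_mult_distrib mult_ac)
    finally show "(x\<^sup>2 + y\<^sup>2 - 2 * x * y * cos \<theta>) ^ k
      = (\<Sum>j\<le>k. (real (k choose j) * (- T) ^ j * S ^ (k - j)) * cos \<theta> ^ j)" .
  qed
  also have "\<dots> = (\<Sum>j\<le>k. (real (k choose j) * (- T) ^ j * S ^ (k - j)) * cos_moment \<nu> j)"
    unfolding cos_moment_def
    by (subst Bochner_Integration.integral_sum)
      (auto intro!: integrable_mult_right integrable_angle_measure[OF \<nu>, where B = 1] abs_cos_power_le)
  \<comment> \<open>The range is extended to an odd upper limit so that it splits into consecutive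
    even and odd indices; the added binomial coefficients are 0.\<close>
  also have "\<dots> = (\<Sum>j\<le>Suc (2 * k). (real (k choose j) * (- T) ^ j * S ^ (k - j)) * cos_moment \<nu> j)"
    by (rule sum.mono_neutral_left) auto
  also have "\<dots> = (\<Sum>i\<le>k. (real (k choose (2 * i)) * T ^ (2 * i) * S ^ (k - 2 * i)) * cos_moment \<nu> (2 * i))"
    unfolding sum.in_pairs_0 by (simp add: cos_moment_odd[OF \<nu>])
  \<comment> \<open>The cross term T^(2i) supplies i factors of x^2 and of y^2 each, and S^(k-2i)
    supplies m - i further factors of x^2 and k - m - i of y^2, so m is the total power of
    x^2.\<close>
  also have "\<dots> = (\<Sum>i\<le>k. \<Sum>m\<le>k. if i \<le> m \<and> i \<le> k - m then
      fact k / (fact i * fact (m - i) * fact (k - m - i) * pochhammer (\<nu> + 1) i)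
        * ((x\<^sup>2) ^ m * (y\<^sup>2) ^ (k - m)) else 0)"
  proof (rule sum.cong[OF refl])
    fix i assume "i \<in> {..k}"
    show "(real (k choose (2 * i)) * T ^ (2 * i) * S ^ (k - 2 * i)) * cos_moment \<nu> (2 * i)
      = (\<Sum>m\<le>k. if i \<le> m \<and> i \<le> k - m then
      fact k / (fact i * fact (m - i) * fact (k - m - i) * pochhammer (\<nu> + 1) i)
        * ((x\<^sup>2) ^ m * (y\<^sup>2) ^ (k - m)) else 0)"
    proof (cases "2 * i \<le> k")
      case False
      then have "\<not> (i \<le> m \<and> i \<le> k - m)" if "m \<le> k" for m
        using that by linarith
      then have "(\<Sum>m\<le>k. if i \<le> m \<and> i \<le> k - m then
        fact k / (fact i * fact (m - i) * fact (k - m - i) * pochhammer (\<nu> + 1) i)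
          * ((x\<^sup>2) ^ m * (y\<^sup>2) ^ (k - m)) else 0) = 0"
        by (intro sum.neutral) auto
      with False show ?thesis by (simp add: binomial_eq_0)
    next
      case True
      have ph: "pochhammer (1 / 2) i > (0::real)"
        by (rule pochhammer_pos) simp
      have "(real (k choose (2 * i)) * T ^ (2 * i) * S ^ (k - 2 * i)) * cos_moment \<nu> (2 * i)
        = (\<Sum>r\<le>k - 2 * i. real (k choose (2 * i)) * (4 ^ i * ((x\<^sup>2) ^ i * (y\<^sup>2) ^ i)) *
           (real (k - 2 * i choose r) * (x\<^sup>2) ^ r * (y\<^sup>2) ^ (k - 2 * i - r)) * cos_moment \<nu> (2 * i))"
        unfolding T2 S_def binomial_ring by (simp only: sum_distrib_left sum_distrib_right)
      also have "\<dots> = (\<Sum>m\<in>{i..k - i}.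
          fact k / (fact i * fact (m - i) * fact (k - m - i) * pochhammer (\<nu> + 1) i)
          * ((x\<^sup>2) ^ m * (y\<^sup>2) ^ (k - m)))"
      proof (rule sum.reindex_bij_witness[of _ "\<lambda>m. m - i" "\<lambda>r. r + i"])
        fix r assume r: "r \<in> {..k - 2 * i}"
        with True have e: "k - 2 * i - r = k - (r + i) - i" "(r + i) - i = r"
          "k - (r + i) = (k - 2 * i - r) + i" by simp_all
        \<comment> \<open>By (2i)! = 4^i (1/2)_i i!, the factorial in the binomial coefficient
          cancels both 4^i and the numerator of the even moment, leaving i! in the
          denominator.\<close>
        have "real (k choose (2 * i)) * 4 ^ i * real (k - 2 * i choose r) * cos_moment \<nu> (2 * i)
           = fact k / (fact i * fact r * fact (k - 2 * i - r) * pochhammer (\<nu> + 1) i)"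
          using True r ph unfolding cos_moment_even[OF \<nu>]
          by (simp add: binomial_fact fact_double power_mult)
        moreover have "real (k choose (2 * i)) * (4 ^ i * ((x\<^sup>2) ^ i * (y\<^sup>2) ^ i)) *
           (real (k - 2 * i choose r) * (x\<^sup>2) ^ r * (y\<^sup>2) ^ (k - 2 * i - r)) * cos_moment \<nu> (2 * i)
           = (real (k choose (2 * i)) * 4 ^ i * real (k - 2 * i choose r) * cos_moment \<nu> (2 * i)) *
             ((x\<^sup>2) ^ (r + i) * (y\<^sup>2) ^ (k - 2 * i - r + i))"
          by (simp add: power_add)
        ultimately show "fact k / (fact i * fact (r + i - i) * fact (k - (r + i) - i) * pochhammer (\<nu> + 1) i)
          * ((x\<^sup>2) ^ (r + i) * (y\<^sup>2) ^ (k - (r + i)))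
          = real (k choose (2 * i)) * (4 ^ i * ((x\<^sup>2) ^ i * (y\<^sup>2) ^ i)) *
           (real (k - 2 * i choose r) * (x\<^sup>2) ^ r * (y\<^sup>2) ^ (k - 2 * i - r)) * cos_moment \<nu> (2 * i)"
          unfolding e(2,3) by simp
      qed (use True in auto)
      also have "\<dots> = (\<Sum>m\<le>k. if i \<le> m \<and> i \<le> k - m then
          fact k / (fact i * fact (m - i) * fact (k - m - i) * pochhammer (\<nu> + 1) i)
          * ((x\<^sup>2) ^ m * (y\<^sup>2) ^ (k - m)) else 0)"
        using True by (intro sum.mono_neutral_cong_left) auto
      finally show ?thesis .
    qed
  qed
  also have "\<dots> = (\<Sum>m\<le>k. \<Sum>i\<le>k. if i \<le> m \<and> i \<le> k - m then
      fact k / (fact i * fact (m - i) * fact (k - m - i) * pochhammer (\<nu> + 1) i)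
        * ((x\<^sup>2) ^ m * (y\<^sup>2) ^ (k - m)) else 0)"
    by (rule sum.swap)
  also have "\<dots> = (\<Sum>m\<le>k. fact k * pochhammer (\<nu> + 1) k /
        (fact m * fact (k - m) * pochhammer (\<nu> + 1) m * pochhammer (\<nu> + 1) (k - m)) *
        ((x\<^sup>2) ^ m * (y\<^sup>2) ^ (k - m)))"
  proof (rule sum.cong[OF refl])
    fix m assume m: "m \<in> {..k}"
    let ?P = "(x\<^sup>2) ^ m * (y\<^sup>2) ^ (k - m)"
    have "(\<Sum>i\<le>k. if i \<le> m \<and> i \<le> k - m then
        fact k / (fact i * fact (m - i) * fact (k - m - i) * pochhammer (\<nu> + 1) i) * ?P else 0)
      = fact k * ?P * (\<Sum>i\<le>k - m. if i \<le> m then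
          1 / (fact i * fact (m - i) * fact (k - m - i) * pochhammer (\<nu> + 1) i) else 0)"
      unfolding sum_distrib_left by (rule sum.mono_neutral_cong_right) auto
    then show "(\<Sum>i\<le>k. if i \<le> m \<and> i \<le> k - m then
        fact k / (fact i * fact (m - i) * fact (k - m - i) * pochhammer (\<nu> + 1) i) * ?P else 0)
      = fact k * pochhammer (\<nu> + 1) k /
        (fact m * fact (k - m) * pochhammer (\<nu> + 1) m * pochhammer (\<nu> + 1) (k - m)) * ?P"
      using m by (simp add: bessel_vandermonde[OF \<nu>])
  qed
  finally show ?thesis .
qed

text \<open>Integrated termwise, the series becomes the Cauchy product of the series at x^2 and at
  y^2.\<close>

lemma bessel_entire_product:
  assumes \<nu>: "\<nu> \<ge> 0"
  shows "(\<integral>\<theta>. bessel_entire \<nu> (x\<^sup>2 + y\<^sup>2 - 2 * x * y * cos \<theta>) \<partial>angle_measure \<nu>)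
    = bessel_entire \<nu> (x\<^sup>2) * bessel_entire \<nu> (y\<^sup>2)"
proof -
  interpret prob_space "angle_measure \<nu>" by (rule prob_space_angle_measure[OF \<nu>])
  let ?c = "bessel_coeff \<nu>"
  let ?w = "\<lambda>\<theta>. x\<^sup>2 + y\<^sup>2 - 2 * x * y * cos \<theta>"
  \<comment> \<open>Largest possible squared third side; the terms are dominated by those of the
    series of exp R, uniformly in \<theta>.\<close>
  define R where "R = (\<bar>x\<bar> + \<bar>y\<bar>)\<^sup>2"
  have R: "\<bar>?w \<theta>\<bar> \<le> R" for \<theta>
  proof -
    have "\<bar>?w \<theta>\<bar> \<le> \<bar>x\<^sup>2 + y\<^sup>2\<bar> + \<bar>2 * x * y * cos \<theta>\<bar>" by (rule abs_triangle_ineq4)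
    also have "\<bar>2 * x * y * cos \<theta>\<bar> \<le> 2 * \<bar>x * y\<bar> * 1"
      using mult_left_mono[of "\<bar>cos \<theta>\<bar>" 1 "2 * \<bar>x * y\<bar>"] by (simp add: abs_mult)
    finally show ?thesis by (simp add: R_def power2_sum abs_mult)
  qed
  have Rk: "\<bar>?c k * ?w \<theta> ^ k\<bar> \<le> inverse (fact k) * R ^ k" for k \<theta>
    unfolding abs_mult power_abs using abs_bessel_coeff_le[OF \<nu>, of k] R
    by (intro mult_mono power_mono) (auto simp: divide_inverse)
  have int: "integrable (angle_measure \<nu>) (\<lambda>\<theta>. ?c k * ?w \<theta> ^ k)" for k
    by (rule integrable_angle_measure[OF \<nu> _ Rk]) simp
  have "(\<integral>\<theta>. bessel_entire \<nu> (?w \<theta>) \<partial>angle_measure \<nu>)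
      = (\<Sum>k. \<integral>\<theta>. ?c k * ?w \<theta> ^ k \<partial>angle_measure \<nu>)"
    unfolding bessel_entire_def
  proof (rule integral_suminf[OF int])
    show "AE \<theta> in angle_measure \<nu>. summable (\<lambda>k. norm (?c k * ?w \<theta> ^ k))"
      using summable_norm_bessel_coeff[OF \<nu>] by simp
    show "summable (\<lambda>k. \<integral>\<theta>. norm (?c k * ?w \<theta> ^ k) \<partial>angle_measure \<nu>)"
    proof (rule summable_comparison_test'[OF summable_exp])
      fix k :: nat
      have "(\<integral>\<theta>. norm (?c k * ?w \<theta> ^ k) \<partial>angle_measure \<nu>) \<le> inverse (fact k) * R ^ k"
        using int[of k] Rk[of k] by (intro integral_le_const) auto
      then show "norm (\<integral>\<theta>. norm (?c k * ?w \<theta> ^ k) \<partial>angle_measure \<nu>) \<le> inverse (fact k) * R ^ k"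
        by simp
    qed
  qed
  also have "\<dots> = (\<Sum>k. \<Sum>m\<le>k. (?c m * (x\<^sup>2) ^ m) * (?c (k - m) * (y\<^sup>2) ^ (k - m)))"
  proof (rule suminf_cong)
    fix k
    have p: "pochhammer (\<nu> + 1) i \<noteq> 0" for i
      using one_le_pochhammer[of "\<nu> + 1" i] \<nu> by simp
    have "?c k * (fact k * pochhammer (\<nu> + 1) k /
        (fact m * fact (k - m) * pochhammer (\<nu> + 1) m * pochhammer (\<nu> + 1) (k - m)) *
        ((x\<^sup>2) ^ m * (y\<^sup>2) ^ (k - m))) = (?c m * (x\<^sup>2) ^ m) * (?c (k - m) * (y\<^sup>2) ^ (k - m))"
      if "m \<le> k" for m
    proof -
      have c: "?c k = (- 1 / 4) ^ m * (- 1 / 4) ^ (k - m) / (fact k * pochhammer (\<nu> + 1) k)"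
        using that by (simp add: bessel_coeff_def flip: power_add)
      show ?thesis
        unfolding c using p by (simp add: bessel_coeff_def mult_ac)
    qed
    then show "(\<integral>\<theta>. ?c k * ?w \<theta> ^ k \<partial>angle_measure \<nu>)
        = (\<Sum>m\<le>k. (?c m * (x\<^sup>2) ^ m) * (?c (k - m) * (y\<^sup>2) ^ (k - m)))"
      unfolding integral_mult_right_zero integral_angle_power[OF \<nu>] sum_distrib_left
      by (intro sum.cong refl) auto
  qed
  also have "\<dots> = bessel_entire \<nu> (x\<^sup>2) * bessel_entire \<nu> (y\<^sup>2)"
    unfolding bessel_entire_def
    by (rule sums_unique[symmetric], rule Cauchy_product_sums)
      (intro summable_norm_bessel_coeff[OF \<nu>])+
  finally show ?thesis .
qed

section \<open>Functionals on bounded functions\<close>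

lemma Linfty_I:
  assumes "f \<in> borel_measurable M" and "AE x in M. cmod (f x) \<le> C" and "C \<ge> 0"
  shows "f \<in> Linfty M" and "Linfty_norm M f \<le> C"
proof -
  have "esssup M (\<lambda>x. ereal (cmod (f x))) \<le> ereal C"
    using assms(1,2) by (intro esssup_I) auto
  then show "f \<in> Linfty M" "Linfty_norm M f \<le> C"
    using assms(1,3) unfolding Linfty_def Linfty_norm_def
    by (cases "esssup M (\<lambda>x. ereal (cmod (f x)))"; auto)+
qed

lemma Linfty_measurable: "f \<in> Linfty M \<Longrightarrow> f \<in> borel_measurable M"
  by (simp add: Linfty_def)

lemma AE_Linfty_norm:
  assumes "f \<in> Linfty M"
  shows "AE x in M. cmod (f x) \<le> Linfty_norm M f"
  using esssup_AE[of "\<lambda>x. ereal (cmod (f x))" M]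
proof eventually_elim
  case (elim x)
  then show ?case
    using assms unfolding Linfty_def Linfty_norm_def
    by (cases "esssup M (\<lambda>x. ereal (cmod (f x)))") auto
qed

text \<open>A negative value would bound a norm almost everywhere, so every statement would hold
  almost everywhere, including a strictly smaller bound. On a null measure the essential supremum is
  minus infinity, which \<open>real_of_ereal\<close> sends to 0.\<close>

lemma Linfty_norm_nonneg:
  assumes f: "f \<in> Linfty M"
  shows "Linfty_norm M f \<ge> 0"
proof (rule ccontr)
  assume neg: "\<not> Linfty_norm M f \<ge> 0"
  have "AE x in M. ereal (cmod (f x)) \<le> ereal (Linfty_norm M f - 1)"
    using AE_Linfty_norm[OF f]
  proof eventually_elim
    case (elim x)
    with neg norm_ge_zero[of "f x"] show ?case by linarith
  qed
  then have "esssup M (\<lambda>x. ereal (cmod (f x))) \<le> ereal (Linfty_norm M f - 1)"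
    using Linfty_measurable[OF f] by (intro esssup_I) auto
  with neg show False
    unfolding Linfty_norm_def by (cases "esssup M (\<lambda>x. ereal (cmod (f x)))") auto
qed

lemma Linfty_obtain_bound:
  assumes "f \<in> Linfty M"
  obtains C where "C \<ge> 0" and "AE x in M. cmod (f x) \<le> C"
proof
  show "AE x in M. cmod (f x) \<le> max 0 (Linfty_norm M f)"
    using AE_Linfty_norm[OF assms] by eventually_elim auto
qed simp

lemma Linfty_add:
  assumes "f \<in> Linfty M" and "g \<in> Linfty M"
  shows "(\<lambda>x. f x + g x) \<in> Linfty M"
proof -
  obtain A where A: "A \<ge> 0" "AE x in M. cmod (f x) \<le> A"
    by (rule Linfty_obtain_bound[OF assms(1)])
  obtain B where B: "B \<ge> 0" "AE x in M. cmod (g x) \<le> B"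
    by (rule Linfty_obtain_bound[OF assms(2)])
  have "AE x in M. cmod (f x + g x) \<le> A + B"
    using A(2) B(2)
  proof eventually_elim
    case (elim x)
    then show ?case
      using norm_triangle_ineq[of "f x" "g x"] by linarith
  qed
  then show ?thesis
    using assms[THEN Linfty_measurable] A(1) B(1)
    by (intro Linfty_I(1)[of _ _ "A + B"]) auto
qed

lemma Linfty_cmult:
  assumes "f \<in> Linfty M"
  shows "(\<lambda>x. c * f x) \<in> Linfty M"
proof -
  obtain A where A: "A \<ge> 0" "AE x in M. cmod (f x) \<le> A"
    by (rule Linfty_obtain_bound[OF assms])
  have "AE x in M. cmod (c * f x) \<le> cmod c * A"
    using A(2) by eventually_elim (simp add: norm_mult mult_left_mono)
  then show ?thesis
    using Linfty_measurable[OF assms] A(1)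
    by (intro Linfty_I(1)[of _ _ "cmod c * A"]) auto
qed

text \<open>With \<epsilon> = 0 this says that m ignores null sets and values off the space; with
  \<epsilon> > 0 it transfers uniform closeness of characters to their values under m. The witness
  is an absolute value because the constant in \<open>Linfty_functional\<close> carries no sign
  condition.\<close>

lemma Linfty_functional_Lipschitz:
  assumes "Linfty_functional M m"
  obtains K where "K \<ge> 0" and
    "\<And>f g \<epsilon>. f \<in> Linfty M \<Longrightarrow> g \<in> Linfty M \<Longrightarrow> \<epsilon> \<ge> 0 \<Longrightarrow>
      AE x in M. cmod (f x - g x) \<le> \<epsilon> \<Longrightarrow> cmod (m f - m g) \<le> K * \<epsilon>"
proof -
  from assms obtain C where add: "\<And>f g. f \<in> Linfty M \<Longrightarrow> g \<in> Linfty M \<Longrightarrow> m (\<lambda>x. f x + g x) = m f + m g"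
    and mult: "\<And>c f. f \<in> Linfty M \<Longrightarrow> m (\<lambda>x. c * f x) = c * m f"
    and C: "\<And>f. f \<in> Linfty M \<Longrightarrow> cmod (m f) \<le> C * Linfty_norm M f"
    unfolding Linfty_functional_def by blast
  show thesis
  proof (rule that[of "\<bar>C\<bar>"])
    fix f g \<epsilon>
    assume fg: "f \<in> Linfty M" "g \<in> Linfty M" and \<epsilon>: "\<epsilon> \<ge> 0" "AE x in M. cmod (f x - g x) \<le> \<epsilon>"
    have h: "(\<lambda>x. f x + (- 1) * g x) \<in> Linfty M"
      by (intro Linfty_add Linfty_cmult fg)
    have "m f - m g = m (\<lambda>x. f x + (- 1) * g x)"
      using add[OF fg(1) Linfty_cmult[OF fg(2), of "- 1"]] mult[OF fg(2), of "- 1"] by simp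
    also have "cmod \<dots> \<le> C * Linfty_norm M (\<lambda>x. f x + (- 1) * g x)"
      by (rule C[OF h])
    also have "\<dots> \<le> \<bar>C\<bar> * \<epsilon>"
      using Linfty_I(2)[OF Linfty_measurable[OF h], of \<epsilon>] \<epsilon> Linfty_norm_nonneg[OF h]
      by (intro mult_mono) auto
    finally show "cmod (m f - m g) \<le> \<bar>C\<bar> * \<epsilon>" .
  qed simp
qed

section \<open>Characters other than the trivial one\<close>

text \<open>Law of cosines: the third side of a triangle with sides x and y enclosing the angle
  \<theta>.\<close>

definition chord :: "real \<Rightarrow> real \<Rightarrow> real \<Rightarrow> real" where
  "chord x y \<theta> = sqrt (x\<^sup>2 + y\<^sup>2 - 2 * x * y * cos \<theta>)"

lemma chord_radicand_nonneg: "0 \<le> x\<^sup>2 + y\<^sup>2 - 2 * x * y * cos (\<theta>::real)"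
proof -
  have "\<bar>2 * x * y * cos \<theta>\<bar> \<le> 2 * \<bar>x * y\<bar>"
    using mult_left_mono[of "\<bar>cos \<theta>\<bar>" 1 "2 * \<bar>x * y\<bar>"] by (simp add: abs_mult)
  also have "\<dots> \<le> x\<^sup>2 + y\<^sup>2"
    using zero_le_power2[of "\<bar>x\<bar> - \<bar>y\<bar>"] by (simp add: power2_diff abs_mult)
  finally show ?thesis by linarith
qed

lemma chord_nonneg [simp]: "chord x y \<theta> \<ge> 0"
  using chord_radicand_nonneg by (simp add: chord_def)

lemma chord_square: "(chord x y \<theta>)\<^sup>2 = x\<^sup>2 + y\<^sup>2 - 2 * x * y * cos \<theta>"
  using chord_radicand_nonneg by (simp add: chord_def)

lemma measurable_chord:
  "chord x y \<in> angle_measure \<nu> \<rightarrow>\<^sub>M restrict_space borel {0..}"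
proof (rule measurable_restrict_space2)
  have "chord x y \<in> borel_measurable (restrict_space borel {0..pi})"
    unfolding chord_def[abs_def] by (intro measurable_restrict_space1) measurable
  then show "chord x y \<in> borel_measurable (angle_measure \<nu>)"
    by (simp add: measurable_cong_sets[OF sets_angle_measure refl])
qed simp

lemma BK_conv_eq: "BK_conv \<nu> x y = distr (angle_measure \<nu>) (restrict_space borel {0..}) (chord x y)"
  by (simp add: BK_conv_def angle_measure_def angle_const_def chord_def[abs_def])

lemma translation_BK_conv:
  assumes "f \<in> borel_measurable (restrict_space borel {0..})"
  shows "translation (BK_conv \<nu>) x f y = (\<integral>\<theta>. f (chord x y \<theta>) \<partial>angle_measure \<nu>)"
  unfolding translation_def BK_conv_eq by (rule integral_distr[OF measurable_chord assms])

section \<open>Haar measure and characters of the Bessel-Kingman hypergroup\<close>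

lemma space_BK_haar [simp]: "space (BK_haar \<nu>) = {0..}"
  by (simp add: BK_haar_def space_restrict_space)

lemma sets_BK_haar [measurable_cong]: "sets (BK_haar \<nu>) = sets (restrict_space borel {0..})"
  by (simp add: BK_haar_def sets_restrict_space)

lemma borel_measurable_BK_haar:
  "borel_measurable (BK_haar \<nu>) = borel_measurable (restrict_space borel {0..})"
  by (rule measurable_cong_sets[OF sets_BK_haar refl])

text \<open>Each term of the Bessel series carries the same factor \<open>?a\<close>, which the
  normalisation of the character cancels. The entire form also absorbs the separate value at
  0.\<close>

lemma BK_char_eq:
  assumes \<nu>: "\<nu> \<ge> 0" and "l * x \<ge> 0"
  shows "BK_char \<nu> l x = complex_of_real (bessel_entire \<nu> ((l * x)\<^sup>2))"
proof (cases "l * x = 0")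
  case True
  then show ?thesis by (auto simp: BK_char_def)
next
  case False
  define z where "z = l * x"
  have z: "z > 0" using False assms(2) unfolding z_def by linarith
  have G: "Gamma (\<nu> + 1) > 0" using \<nu> by (intro Gamma_real_pos) simp
  let ?a = "z powr \<nu> / (2 powr \<nu> * Gamma (\<nu> + 1))"
  have "(-1) ^ k / (fact k * Gamma (\<nu> + real k + 1)) * (z / 2) powr (2 * real k + \<nu>)
      = (bessel_coeff \<nu> k * (z\<^sup>2) ^ k) * ?a" for k
  proof -
    have "\<nu> + 1 \<notin> \<int>\<^sub>\<le>\<^sub>0" using \<nu> by (auto elim!: nonpos_Ints_cases)
    then have "pochhammer (\<nu> + 1) k * Gamma (\<nu> + 1) = Gamma (\<nu> + 1 + real k)"
      using pochhammer_Gamma[of "\<nu> + 1" k] G by simp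
    then have p: "Gamma (\<nu> + real k + 1) = pochhammer (\<nu> + 1) k * Gamma (\<nu> + 1)"
      by (simp add: add_ac)
    have "(z / 2) powr (2 * real k) = (z / 2) ^ (2 * k)"
      using z powr_realpow[of "z / 2" "2 * k"] by simp
    then have "(z / 2) powr (2 * real k + \<nu>) = (z / 2) ^ (2 * k) * (z powr \<nu> / 2 powr \<nu>)"
      by (simp only: powr_add powr_divide[of z 2 \<nu>])
    also have "(z / 2) ^ (2 * k) = (1 / 4) ^ k * (z\<^sup>2) ^ k"
      by (simp add: power_mult power_divide)
    finally show ?thesis
      by (simp add: p bessel_coeff_def power_minus[of "1 / 4"] mult_ac)
  qed
  then have "Bessel_J \<nu> z = bessel_entire \<nu> (z\<^sup>2) * ?a"
    unfolding Bessel_J_def bessel_entire_def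
    using suminf_mult2[OF summable_bessel_coeff[OF \<nu>], of "z\<^sup>2" ?a] by simp
  then show ?thesis
    using False z G by (simp add: BK_char_def powr_minus flip: z_def)
qed

lemma BK_char_measurable:
  assumes \<nu>: "\<nu> \<ge> 0" and l: "l \<ge> 0"
  shows "BK_char \<nu> l \<in> borel_measurable (restrict_space borel {0..})"
proof -
  have "(\<lambda>x. bessel_entire \<nu> ((l * x)\<^sup>2)) \<in> borel_measurable borel"
    by (intro borel_measurable_continuous_onI
        continuous_on_compose2[OF continuous_on_bessel_entire[OF \<nu>]] continuous_intros) auto
  then have "(\<lambda>x. complex_of_real (bessel_entire \<nu> ((l * x)\<^sup>2))) \<in> borel_measurable (restrict_space borel {0..})"
    by (intro measurable_restrict_space1) measurable
  then show ?thesis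
    by (rule measurable_cong[THEN iffD1, rotated])
      (use assms in \<open>simp add: BK_char_eq space_restrict_space\<close>)
qed

text \<open>Scaling a triangle by l scales its third side by l, so the product formula at l x and l
  y suffices.\<close>

lemma BK_char_translation:
  assumes "\<nu> \<ge> 0" "l \<ge> 0" "x \<ge> 0" "y \<ge> 0"
  shows "translation (BK_conv \<nu>) x (BK_char \<nu> l) y = BK_char \<nu> l x * BK_char \<nu> l y"
proof -
  have "translation (BK_conv \<nu>) x (BK_char \<nu> l) y = (\<integral>\<theta>. BK_char \<nu> l (chord x y \<theta>) \<partial>angle_measure \<nu>)"
    using assms by (intro translation_BK_conv BK_char_measurable)
  also have "\<dots> = (\<integral>\<theta>. complex_of_real (bessel_entire \<nu>
      ((l * x)\<^sup>2 + (l * y)\<^sup>2 - 2 * (l * x) * (l * y) * cos \<theta>)) \<partial>angle_measure \<nu>)"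
  proof (intro Bochner_Integration.integral_cong refl)
    fix \<theta>
    have "(l * chord x y \<theta>)\<^sup>2 = (l * x)\<^sup>2 + (l * y)\<^sup>2 - 2 * (l * x) * (l * y) * cos \<theta>"
      unfolding power_mult_distrib chord_square by (simp add: algebra_simps power2_eq_square)
    then show "BK_char \<nu> l (chord x y \<theta>) = complex_of_real (bessel_entire \<nu>
        ((l * x)\<^sup>2 + (l * y)\<^sup>2 - 2 * (l * x) * (l * y) * cos \<theta>))"
      using assms by (subst BK_char_eq) auto
  qed
  also have "\<dots> = complex_of_real (bessel_entire \<nu> ((l * x)\<^sup>2) * bessel_entire \<nu> ((l * y)\<^sup>2))"
    by (simp only: integral_complex_of_real bessel_entire_product[OF assms(1)])
  also have "\<dots> = BK_char \<nu> l x * BK_char \<nu> l y"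
    using assms by (simp add: BK_char_eq)
  finally show ?thesis .
qed

section \<open>Boundedness, separation and uniform closeness of characters\<close>

lemma bessel_entire_square_bounded:
  assumes \<nu>: "\<nu> \<ge> 0"
  obtains B where "B \<ge> 0" and "\<And>z. z \<ge> 0 \<Longrightarrow> \<bar>bessel_entire \<nu> (z\<^sup>2)\<bar> \<le> B"
proof -
  let ?h = "\<lambda>z. bessel_entire \<nu> (z\<^sup>2)"
  have "\<forall>\<^sub>F z in at_top. \<bar>?h z\<bar> < 1"
    using tendstoD[OF bessel_entire_square_tendsto_0[OF \<nu>], of 1] by simp
  then obtain Z where Z: "\<And>z. z \<ge> Z \<Longrightarrow> \<bar>?h z\<bar> < 1"
    by (auto simp: eventually_at_top_linorder)
  have "compact (?h ` {0..max 0 Z})"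
    by (intro compact_continuous_image continuous_on_compose2[OF continuous_on_bessel_entire[OF \<nu>]]
        continuous_intros) auto
  then obtain B where B: "\<forall>z\<in>{0..max 0 Z}. \<bar>?h z\<bar> \<le> B"
    by (auto dest!: compact_imp_bounded simp: bounded_iff)
  show thesis
  proof (rule that[of "max B 1"])
    fix z :: real assume "z \<ge> 0"
    then show "\<bar>?h z\<bar> \<le> max B 1"
      using bspec[OF B, of z] Z[of z] by (cases "z \<ge> Z") auto
  qed simp
qed

lemma BK_char_Linfty:
  assumes "\<nu> \<ge> 0" "l \<ge> 0"
  shows "BK_char \<nu> l \<in> Linfty (BK_haar \<nu>)"
proof -
  obtain B where B: "B \<ge> 0" "\<And>z. z \<ge> 0 \<Longrightarrow> \<bar>bessel_entire \<nu> (z\<^sup>2)\<bar> \<le> B"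
    using bessel_entire_square_bounded[OF assms(1)] by blast
  have "AE x in BK_haar \<nu>. cmod (BK_char \<nu> l x) \<le> B"
    using assms by (intro AE_I2) (simp add: BK_char_eq B)
  then show ?thesis
    using assms B(1) by (intro Linfty_I(1)[of _ _ B]) (auto simp: borel_measurable_BK_haar BK_char_measurable)
qed

text \<open>If two of the functions agree then \<open>g (z\<^sup>2) = g ((r z)\<^sup>2)\<close> for some \<open>r < 1\<close>, so
  \<open>g\<close> is determined by its value at \<open>0\<close>, against its decay at infinity.\<close>

lemma bessel_entire_dilation_inj:
  assumes \<nu>: "\<nu> \<ge> 0" and pq: "0 < p" "p < q"
  shows "\<exists>x\<ge>0. bessel_entire \<nu> ((p * x)\<^sup>2) \<noteq> bessel_entire \<nu> ((q * x)\<^sup>2)"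
proof (rule ccontr)
  assume "\<not> ?thesis"
  then have eq: "bessel_entire \<nu> ((p * x)\<^sup>2) = bessel_entire \<nu> ((q * x)\<^sup>2)" if "x \<ge> 0" for x
    using that by blast
  define r where "r = p / q"
  have r: "0 < r" "r < 1" using pq by (auto simp: r_def)
  have step: "bessel_entire \<nu> ((r * z)\<^sup>2) = bessel_entire \<nu> (z\<^sup>2)" if "z \<ge> 0" for z
    using eq[of "z / q"] that pq by (simp add: r_def)
  have "bessel_entire \<nu> (z\<^sup>2) = 1" if z: "z \<ge> 0" for z
  proof -
    have "bessel_entire \<nu> ((r ^ n * z)\<^sup>2) = bessel_entire \<nu> (z\<^sup>2)" for n
    proof (induction n)
      case (Suc n)
      then show ?case
        using step[of "r ^ n * z"] r z by (simp add: mult.assoc)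
    qed simp
    moreover have "(\<lambda>n. bessel_entire \<nu> ((r ^ n * z)\<^sup>2)) \<longlonglongrightarrow> bessel_entire \<nu> ((0 * z)\<^sup>2)"
      using r by (intro isCont_tendsto_compose[OF DERIV_isCont[OF bessel_entire_has_derivative[OF \<nu>]]]
          tendsto_intros LIMSEQ_power_zero) auto
    ultimately show ?thesis
      by (simp add: LIMSEQ_const_iff)
  qed
  then have "\<forall>\<^sub>F z in at_top. bessel_entire \<nu> (z\<^sup>2) = 1"
    by (intro eventually_mono[OF eventually_ge_at_top[of 0]])
  then have "((\<lambda>z. bessel_entire \<nu> (z\<^sup>2)) \<longlongrightarrow> 1) at_top"
    by (rule tendsto_eventually)
  from tendsto_unique[OF _ this bessel_entire_square_tendsto_0[OF \<nu>]] show False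
    by simp
qed

lemma BK_char_inj:
  assumes "\<nu> \<ge> 0" "t > 0" "l > 0" "t \<noteq> l"
  obtains x where "x \<ge> 0" "BK_char \<nu> t x \<noteq> BK_char \<nu> l x"
proof -
  have "\<exists>x\<ge>0. bessel_entire \<nu> ((t * x)\<^sup>2) \<noteq> bessel_entire \<nu> ((l * x)\<^sup>2)"
    using bessel_entire_dilation_inj[of \<nu> t l] bessel_entire_dilation_inj[of \<nu> l t] assms
    by (metis linorder_neqE_linordered_idom)
  then show thesis
    using that assms by (auto simp: BK_char_eq)
qed

text \<open>The arguments l x and l (1 + s) x drift apart without bound as x grows, so uniform
  continuity helps only up to some Z; past Z both values are already below \<epsilon>/2.\<close>

lemma BK_char_uniformly_close:
  assumes \<nu>: "\<nu> \<ge> 0" and l: "l > 0" and \<epsilon>: "\<epsilon> > 0"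
  obtains t where "t > 0" "t \<noteq> l" "\<And>x. x \<ge> 0 \<Longrightarrow> cmod (BK_char \<nu> l x - BK_char \<nu> t x) \<le> \<epsilon>"
proof -
  let ?h = "\<lambda>z. bessel_entire \<nu> (z\<^sup>2)"
  have "\<forall>\<^sub>F z in at_top. \<bar>?h z\<bar> < \<epsilon> / 2"
    using tendstoD[OF bessel_entire_square_tendsto_0[OF \<nu>], of "\<epsilon> / 2"] \<epsilon> by simp
  then obtain Z' where Z': "\<And>z. z \<ge> Z' \<Longrightarrow> \<bar>?h z\<bar> < \<epsilon> / 2"
    by (auto simp: eventually_at_top_linorder)
  define Z where "Z = max Z' 1"
  have Z: "Z > 0" "\<And>z. z \<ge> Z \<Longrightarrow> \<bar>?h z\<bar> < \<epsilon> / 2"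
    using Z' by (auto simp: Z_def)
  have "uniformly_continuous_on {0..2 * Z} ?h"
    by (intro compact_uniformly_continuous continuous_on_compose2[OF continuous_on_bessel_entire[OF \<nu>]]
        continuous_intros) auto
  then obtain d where d: "d > 0"
    "\<And>z w. z \<in> {0..2 * Z} \<Longrightarrow> w \<in> {0..2 * Z} \<Longrightarrow> dist w z < d \<Longrightarrow> dist (?h w) (?h z) < \<epsilon>"
    using \<epsilon> unfolding uniformly_continuous_on_def by metis
  \<comment> \<open>The bound 1 keeps the dilated argument inside [0, 2Z]; the other bound gives s Z
    < d.\<close>
  define s where "s = min 1 (d / (2 * Z))"
  have s: "0 < s" "s \<le> 1" "s * Z < d"
    using d(1) Z(1) by (auto simp: s_def min_def field_simps)
  show thesis
  proof (rule that[of "l * (1 + s)"])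
    fix x :: real assume x: "x \<ge> 0"
    have "\<bar>?h (l * x) - ?h (l * (1 + s) * x)\<bar> \<le> \<epsilon>"
    proof (cases "l * x \<ge> Z")
      case True
      also have "l * x \<le> l * (1 + s) * x"
        using l s x by (simp add: algebra_simps)
      finally show ?thesis
        using Z(2)[of "l * x"] Z(2)[of "l * (1 + s) * x"] True by linarith
    next
      case False
      have e: "l * (1 + s) * x = l * x + s * (l * x)" by (simp add: algebra_simps)
      have "s * (l * x) \<le> s * Z" using False s by (intro mult_left_mono) auto
      moreover have "s * (l * x) \<le> 1 * (l * x)" using l x s by (intro mult_right_mono) auto
      moreover have "0 \<le> s * (l * x)" "0 \<le> l * x" using l x s by auto
      ultimately have "l * x \<in> {0..2 * Z}" "l * (1 + s) * x \<in> {0..2 * Z}"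
        "dist (l * (1 + s) * x) (l * x) < d"
        unfolding e using False s(3) by (auto simp: dist_real_def)
      from d(2)[OF this] show ?thesis by (simp add: dist_real_def abs_minus_commute)
    qed
    then show "cmod (BK_char \<nu> l x - BK_char \<nu> (l * (1 + s)) x) \<le> \<epsilon>"
      using \<nu> l s x by (simp add: BK_char_eq flip: of_real_diff)
  qed (use l s in auto)
qed

lemma BK_not_amenable:
  assumes \<nu>: "\<nu> \<ge> 0" and l: "l > 0"
  shows "\<not> alpha_amenable (BK_haar \<nu>) (BK_conv \<nu>) (BK_char \<nu> l)"
proof
  assume "alpha_amenable (BK_haar \<nu>) (BK_conv \<nu>) (BK_char \<nu> l)"
  then obtain m where m: "Linfty_functional (BK_haar \<nu>) m" "m (BK_char \<nu> l) = 1"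
    "\<And>f x. f \<in> Linfty (BK_haar \<nu>) \<Longrightarrow> x \<ge> 0 \<Longrightarrow> m (translation (BK_conv \<nu>) x f) = BK_char \<nu> l x * m f"
    unfolding alpha_amenable_def by auto
  obtain K where K: "K \<ge> 0" "\<And>f g \<epsilon>. f \<in> Linfty (BK_haar \<nu>) \<Longrightarrow> g \<in> Linfty (BK_haar \<nu>) \<Longrightarrow> \<epsilon> \<ge> 0 \<Longrightarrow>
      AE x in BK_haar \<nu>. cmod (f x - g x) \<le> \<epsilon> \<Longrightarrow> cmod (m f - m g) \<le> K * \<epsilon>"
    using Linfty_functional_Lipschitz[OF m(1)] by blast
  have vanish: "m (BK_char \<nu> t) = 0" if t: "t > 0" "t \<noteq> l" for t
  proof -
    obtain x where x: "x \<ge> 0" "BK_char \<nu> t x \<noteq> BK_char \<nu> l x"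
      using BK_char_inj[OF \<nu> t(1) l t(2)] by blast
    have L: "BK_char \<nu> t \<in> Linfty (BK_haar \<nu>)"
      using \<nu> t by (intro BK_char_Linfty) auto
    have c: "(\<lambda>y. BK_char \<nu> t x * BK_char \<nu> t y) \<in> Linfty (BK_haar \<nu>)"
      by (rule Linfty_cmult[OF L])
    have eq: "translation (BK_conv \<nu>) x (BK_char \<nu> t) y = BK_char \<nu> t x * BK_char \<nu> t y"
      if "y \<ge> 0" for y using BK_char_translation \<nu> t x(1) that by simp
    have "translation (BK_conv \<nu>) x (BK_char \<nu> t) \<in> Linfty (BK_haar \<nu>)"
    proof -
      obtain C where C: "C \<ge> 0" "AE y in BK_haar \<nu>. cmod (BK_char \<nu> t x * BK_char \<nu> t y) \<le> C"
        using Linfty_obtain_bound[OF c] by blast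
      have "AE y in BK_haar \<nu>. cmod (translation (BK_conv \<nu>) x (BK_char \<nu> t) y) \<le> C"
        using C(2) AE_space by eventually_elim (simp add: eq)
      moreover have "translation (BK_conv \<nu>) x (BK_char \<nu> t) \<in> borel_measurable (BK_haar \<nu>)"
        using Linfty_measurable[OF c] by (rule measurable_cong[THEN iffD1, rotated]) (simp add: eq)
      ultimately show ?thesis by (rule Linfty_I(1)[OF _ _ C(1), rotated])
    qed
    \<comment> \<open>The product formula is known only for y \<ge> 0, so the two total functions
      may differ elsewhere; the Lipschitz bound with \<epsilon> = 0 identifies their values under
      m.\<close>
    moreover have "AE y in BK_haar \<nu>.
        cmod (translation (BK_conv \<nu>) x (BK_char \<nu> t) y - BK_char \<nu> t x * BK_char \<nu> t y) \<le> 0"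
      by (intro AE_I2) (simp add: eq)
    ultimately have "cmod (m (translation (BK_conv \<nu>) x (BK_char \<nu> t)) - m (\<lambda>y. BK_char \<nu> t x * BK_char \<nu> t y)) \<le> K * 0"
      by (intro K(2) c) auto
    then have "m (translation (BK_conv \<nu>) x (BK_char \<nu> t)) = BK_char \<nu> t x * m (BK_char \<nu> t)"
      using m(1) L by (simp add: Linfty_functional_def)
    with m(3)[OF L x(1)] x(2) show ?thesis by simp
  qed
  \<comment> \<open>This tolerance makes the error K / (K + 1) < 1, also when K = 0, whereas the two
    values of m differ by exactly 1.\<close>
  have "1 / (K + 1) > 0" using K(1) by simp
  from BK_char_uniformly_close[OF \<nu> l this] obtain t where t: "t > 0" "t \<noteq> l"
    "\<And>x. x \<ge> 0 \<Longrightarrow> cmod (BK_char \<nu> l x - BK_char \<nu> t x) \<le> 1 / (K + 1)"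
    by blast
  have "cmod (m (BK_char \<nu> l) - m (BK_char \<nu> t)) \<le> K * (1 / (K + 1))"
    using \<nu> l t K(1) by (intro K(2) BK_char_Linfty AE_I2) auto
  also have "\<dots> < 1" using K(1) by (simp add: field_simps)
  finally show False by (simp add: m(2) vanish[OF t(1,2)])
qed

section \<open>Symmetry of translation\<close>

lemma nn_integral_angle_measure:
  assumes h: "h \<in> borel_measurable borel"
  shows "(\<integral>\<^sup>+\<theta>. h \<theta> \<partial>angle_measure \<nu>)
    = (\<integral>\<^sup>+\<theta>. h \<theta> * ennreal (angle_const \<nu> * sin \<theta> powr (2 * \<nu>)) * indicator {0..pi} \<theta> \<partial>lborel)"
proof -
  have "h \<in> borel_measurable (restrict_space lborel {0..pi})"
    using h by (intro measurable_restrict_space1) auto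
  moreover have "(\<lambda>\<theta>. ennreal (angle_const \<nu> * sin \<theta> powr (2 * \<nu>))) \<in> borel_measurable (restrict_space lborel {0..pi})"
    by (intro measurable_restrict_space1) measurable
  ultimately show ?thesis
    unfolding angle_measure_def
    by (simp add: nn_integral_density nn_integral_restrict_space mult_ac)
qed

lemma nn_integral_BK_haar:
  assumes h: "h \<in> borel_measurable borel"
  shows "(\<integral>\<^sup>+x. h x \<partial>BK_haar \<nu>)
    = (\<integral>\<^sup>+x. h x * ennreal (x powr (2 * \<nu> + 1)) * indicator {0..} x \<partial>lborel)"
proof -
  have "h \<in> borel_measurable (restrict_space lborel {0..})"
    using h by (intro measurable_restrict_space1) auto
  moreover have "(\<lambda>x. ennreal (x powr (2 * \<nu> + 1))) \<in> borel_measurable (restrict_space lborel {0..})"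
    by (intro measurable_restrict_space1) measurable
  ultimately show ?thesis
    unfolding BK_haar_def
    by (simp add: nn_integral_density nn_integral_restrict_space mult_ac)
qed

text \<open>Heron: \<open>heron x y z\<close> is sixteen times the squared area of the triangle with sides
  \<open>x\<close>, \<open>y\<close>, \<open>z\<close>. Being symmetric in \<open>y\<close> and \<open>z\<close>, it makes translation by \<open>x\<close>
  self-adjoint.\<close>

definition heron :: "real \<Rightarrow> real \<Rightarrow> real \<Rightarrow> real" where
  "heron x y z = 4 * x\<^sup>2 * y\<^sup>2 - (x\<^sup>2 + y\<^sup>2 - z\<^sup>2)\<^sup>2"

text \<open>Lebesgue density in z of the law of the third side, multiplied by the Haar weight of y.
  Including the weight of y is what makes the expression symmetric in y and z.\<close>

definition BK_kernel :: "real \<Rightarrow> real \<Rightarrow> real \<Rightarrow> real \<Rightarrow> real" where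
  "BK_kernel \<nu> x y z =
     (if 0 < y \<and> 0 < z \<and> \<bar>x - y\<bar> \<le> z \<and> z \<le> x + y
      then 2 * angle_const \<nu> * (2 * x) powr (- (2 * \<nu>)) * (y * z) * heron x y z powr (\<nu> - 1 / 2)
      else 0)"

lemma heron_commute: "heron x y z = heron x z y"
  by (simp add: heron_def power2_eq_square algebra_simps)

lemma BK_kernel_commute: "BK_kernel \<nu> x y z = BK_kernel \<nu> x z y"
proof -
  have "0 < y \<and> 0 < z \<and> \<bar>x - y\<bar> \<le> z \<and> z \<le> x + y \<longleftrightarrow> 0 < z \<and> 0 < y \<and> \<bar>x - z\<bar> \<le> y \<and> y \<le> x + z"
    by auto
  then show ?thesis
    unfolding BK_kernel_def heron_commute[of x y z] by (simp add: mult_ac)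
qed

lemma borel_measurable_chord [measurable]: "chord x y \<in> borel_measurable borel"
  unfolding chord_def[abs_def] by measurable

text \<open>The third side \<open>z\<close> of the triangle is substituted for the angle \<open>\<theta>\<close>.\<close>

lemma nn_integral_angle_eq_kernel:
  fixes f :: "real \<Rightarrow> ennreal"
  assumes f: "f \<in> borel_measurable borel" and \<nu>: "\<nu> \<ge> 0" and x: "x > 0" and y: "y > 0" "y \<noteq> x"
  shows "(\<integral>\<^sup>+\<theta>. f (chord x y \<theta>) \<partial>angle_measure \<nu>) * ennreal (y powr (2 * \<nu> + 1))
    = (\<integral>\<^sup>+z. f z * ennreal (BK_kernel \<nu> x y z) \<partial>lborel)"
proof -
  let ?H = "\<lambda>z. 2 * angle_const \<nu> * (2 * x) powr (- (2 * \<nu>)) * (y * z) * heron x y z powr (\<nu> - 1 / 2)"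
  let ?z' = "\<lambda>\<theta>. x * y * sin \<theta> / chord x y \<theta>"
  \<comment> \<open>The assumption y \<noteq> x keeps the chord away from 0, where the square root
    is not differentiable.\<close>
  have rad: "x\<^sup>2 + y\<^sup>2 - 2 * x * y * cos \<theta> > 0" for \<theta>
  proof -
    have "2 * x * y * cos \<theta> \<le> 2 * x * y * 1"
      using x y by (intro mult_left_mono) auto
    moreover have "(x - y)\<^sup>2 > 0" using y by simp
    ultimately show ?thesis by (simp add: power2_diff)
  qed
  have pos: "chord x y \<theta> > 0" for \<theta>
    using rad by (simp add: chord_def)
  have deriv: "(chord x y has_real_derivative ?z' \<theta>) (at \<theta>)" for \<theta>
    unfolding chord_def[abs_def] using rad[of \<theta>]
    by (auto intro!: derivative_eq_intros simp: field_simps)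
  have cont: "continuous_on {0..pi} ?z'"
  proof (intro continuous_intros ballI)
    show "continuous_on {0..pi} (chord x y)"
      unfolding chord_def[abs_def] by (intro continuous_intros)
    show "chord x y \<theta> \<noteq> 0" for \<theta> using pos[of \<theta>] by simp
  qed
  have "chord x y 0 = sqrt ((x - y)\<^sup>2)" "chord x y pi = sqrt ((x + y)\<^sup>2)"
    by (simp_all add: chord_def power2_diff power2_sum)
  then have ends: "chord x y 0 = \<bar>x - y\<bar>" "chord x y pi = x + y"
    using x y unfolding real_sqrt_abs by simp_all
  \<comment> \<open>On the chord \<open>heron\<close> equals (2xy sin \<theta>)^2, so its power
    \<nu> - 1/2 yields sin^(2\<nu>-1) and the Jacobian supplies the missing sine. If sin \<theta> =
    0, both sides are 0.\<close>
  have jac: "?H (chord x y \<theta>) * ?z' \<theta> = angle_const \<nu> * sin \<theta> powr (2 * \<nu>) * y powr (2 * \<nu> + 1)"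
    if \<theta>: "\<theta> \<in> {0..pi}" for \<theta>
  proof (cases "sin \<theta> = 0")
    case False
    with sin_ge_zero[of \<theta>] \<theta> have s: "sin \<theta> > 0" by simp
    let ?a = "2 * x * y * sin \<theta>"
    have a: "?a > 0" using s x y by simp
    have "heron x y (chord x y \<theta>) = 4 * x\<^sup>2 * y\<^sup>2 * (sin \<theta>)\<^sup>2"
      unfolding heron_def chord_square sin_squared_eq
      by (simp add: power2_eq_square algebra_simps)
    also have "\<dots> = ?a powr 2"
      using a by (simp add: power_mult_distrib)
    finally have "heron x y (chord x y \<theta>) powr (\<nu> - 1 / 2) = ?a powr (2 * \<nu> - 1)"
      by (simp add: powr_powr algebra_simps)
    also have "\<dots> = (2 * x) powr (2 * \<nu>) * y powr (2 * \<nu>) * sin \<theta> powr (2 * \<nu>) / ?a"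
    proof -
      have "?a powr (2 * \<nu> - 1) = ?a powr (2 * \<nu>) / ?a"
        unfolding powr_diff using a by (simp only: powr_one order_less_imp_le)
      also have "?a powr (2 * \<nu>) = (2 * x) powr (2 * \<nu>) * y powr (2 * \<nu>) * sin \<theta> powr (2 * \<nu>)"
        by (simp only: powr_mult)
      finally show ?thesis .
    qed
    finally have D: "heron x y (chord x y \<theta>) powr (\<nu> - 1 / 2)
      = (2 * x) powr (2 * \<nu>) * y powr (2 * \<nu>) * sin \<theta> powr (2 * \<nu>) / ?a" .
    have "(2 * x) powr (2 * \<nu>) \<noteq> 0" using x by simp
    then show ?thesis
      unfolding D powr_minus powr_add using s x y pos[of \<theta>] by (simp add: divide_simps)
  qed simp
  have Hpos: "?H z \<ge> 0" if "z \<ge> 0" for z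
    using angle_const_pos[OF \<nu>] x y that by (intro mult_nonneg_nonneg) auto
  have "(\<integral>\<^sup>+z. f z * ennreal (BK_kernel \<nu> x y z) \<partial>lborel)
      = (\<integral>\<^sup>+z. (f z * ennreal (?H z)) * indicator {chord x y 0..chord x y pi} z \<partial>lborel)"
    unfolding ends using x y by (intro nn_integral_cong) (auto simp: BK_kernel_def split: split_indicator)
  also have "\<dots> = (\<integral>\<^sup>+\<theta>. (f (chord x y \<theta>) * ennreal (?H (chord x y \<theta>))) * ennreal (?z' \<theta>) * indicator {0..pi} \<theta> \<partial>lborel)"
  proof (rule nn_integral_substitution_aux[OF _ _ deriv cont])
    show "(\<lambda>z. f z * ennreal (?H z)) \<in> borel_measurable borel"
      using f unfolding heron_def by measurable
    show "0 \<le> ?z' \<theta>" if "\<theta> \<in> {0..pi}" for \<theta>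
      using x y that sin_ge_zero[of \<theta>] by (intro divide_nonneg_nonneg mult_nonneg_nonneg) auto
  qed auto
  also have "\<dots> = (\<integral>\<^sup>+\<theta>. (f (chord x y \<theta>) * ennreal (angle_const \<nu> * sin \<theta> powr (2 * \<nu>)) * indicator {0..pi} \<theta>)
      * ennreal (y powr (2 * \<nu> + 1)) \<partial>lborel)"
  proof (intro nn_integral_cong)
    fix \<theta> :: real
    show "(f (chord x y \<theta>) * ennreal (?H (chord x y \<theta>))) * ennreal (?z' \<theta>) * indicator {0..pi} \<theta>
      = (f (chord x y \<theta>) * ennreal (angle_const \<nu> * sin \<theta> powr (2 * \<nu>)) * indicator {0..pi} \<theta>)
      * ennreal (y powr (2 * \<nu> + 1))"
    proof (cases "\<theta> \<in> {0..pi}")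
      case True
      have "ennreal (?H (chord x y \<theta>)) * ennreal (?z' \<theta>)
          = ennreal (angle_const \<nu> * sin \<theta> powr (2 * \<nu>)) * ennreal (y powr (2 * \<nu> + 1))"
        unfolding ennreal_mult'[symmetric, OF Hpos[OF chord_nonneg]] jac[OF True]
        using angle_const_pos[OF \<nu>] by (intro ennreal_mult') simp
      then show ?thesis
        using True by (simp add: mult.assoc)
    qed simp
  qed
  also have "\<dots> = (\<integral>\<^sup>+\<theta>. f (chord x y \<theta>) \<partial>angle_measure \<nu>) * ennreal (y powr (2 * \<nu> + 1))"
    using f by (subst nn_integral_multc) (auto simp: nn_integral_angle_measure)
  finally show ?thesis by (rule sym)
qed

section \<open>Self-adjointness of translation\<close>

lemma id_angle_measure_borel: "(\<lambda>\<theta>. \<theta>) \<in> borel_measurable (angle_measure \<nu>)"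
  by (simp add: measurable_cong_sets[OF sets_angle_measure refl] measurable_restrict_space1)

lemma measurable_chord_pair:
  assumes "(\<lambda>y. y) \<in> borel_measurable N"
  shows "(\<lambda>p. chord x (fst p) (snd p)) \<in> borel_measurable (N \<Otimes>\<^sub>M angle_measure \<nu>)"
proof -
  have [measurable]: "fst \<in> borel_measurable (N \<Otimes>\<^sub>M angle_measure \<nu>)"
    "snd \<in> borel_measurable (N \<Otimes>\<^sub>M angle_measure \<nu>)"
    using measurable_compose[OF measurable_fst assms] measurable_compose[OF measurable_snd id_angle_measure_borel]
    by auto
  show ?thesis unfolding chord_def by measurable
qed

lemma borel_measurable_nn_integral_chord:
  assumes \<nu>: "\<nu> \<ge> 0" and f: "f \<in> borel_measurable borel"
  shows "(\<lambda>y. \<integral>\<^sup>+\<theta>. f (chord x y \<theta>) \<partial>angle_measure \<nu>) \<in> borel_measurable borel"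
proof -
  interpret prob_space "angle_measure \<nu>" by (rule prob_space_angle_measure[OF \<nu>])
  have "(\<lambda>p. f (chord x (fst p) (snd p))) \<in> borel_measurable (borel \<Otimes>\<^sub>M angle_measure \<nu>)"
    by (rule measurable_compose[OF measurable_chord_pair f]) simp
  then show ?thesis
    by (intro borel_measurable_nn_integral) (simp add: case_prod_beta)
qed

lemma nn_integral_translation_eq_kernel:
  fixes f g :: "real \<Rightarrow> ennreal"
  assumes [measurable]: "f \<in> borel_measurable borel" "g \<in> borel_measurable borel"
    and \<nu>: "\<nu> \<ge> 0" and x: "x > 0"
  shows "(\<integral>\<^sup>+y. (\<integral>\<^sup>+\<theta>. f (chord x y \<theta>) \<partial>angle_measure \<nu>) * g y \<partial>BK_haar \<nu>)
    = (\<integral>\<^sup>+y. (\<integral>\<^sup>+z. f z * g y * ennreal (BK_kernel \<nu> x y z) \<partial>lborel) \<partial>lborel)"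
proof -
  note [measurable] = borel_measurable_nn_integral_chord[OF \<nu>]
  have [measurable]: "BK_kernel \<nu> x y \<in> borel_measurable borel" for y
    unfolding BK_kernel_def[abs_def] heron_def by measurable
  have "(\<integral>\<^sup>+y. (\<integral>\<^sup>+\<theta>. f (chord x y \<theta>) \<partial>angle_measure \<nu>) * g y \<partial>BK_haar \<nu>)
      = (\<integral>\<^sup>+y. (\<integral>\<^sup>+\<theta>. f (chord x y \<theta>) \<partial>angle_measure \<nu>) * g y
          * ennreal (y powr (2 * \<nu> + 1)) * indicator {0..} y \<partial>lborel)"
    by (rule nn_integral_BK_haar) measurable
  also have "\<dots> = (\<integral>\<^sup>+y. (\<integral>\<^sup>+z. f z * g y * ennreal (BK_kernel \<nu> x y z) \<partial>lborel) \<partial>lborel)"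
  proof (rule nn_integral_cong_AE)
    \<comment> \<open>The two points that the substitution of the third side does not cover form a
      null set; for negative y both integrands vanish.\<close>
    have "AE y in lborel. y \<noteq> x" "AE y in lborel. y \<noteq> (0::real)"
      by (rule AE_lborel_singleton)+
    then show "AE y in lborel. (\<integral>\<^sup>+\<theta>. f (chord x y \<theta>) \<partial>angle_measure \<nu>) * g y
          * ennreal (y powr (2 * \<nu> + 1)) * indicator {0..} y
        = (\<integral>\<^sup>+z. f z * g y * ennreal (BK_kernel \<nu> x y z) \<partial>lborel)"
    proof eventually_elim
      case (elim y)
      show ?case
      proof (cases "y > 0")
        case True
        have "(\<integral>\<^sup>+z. f z * g y * ennreal (BK_kernel \<nu> x y z) \<partial>lborel)
            = (\<integral>\<^sup>+z. f z * ennreal (BK_kernel \<nu> x y z) * g y \<partial>lborel)"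
          by (simp add: mult_ac)
        also have "\<dots> = (\<integral>\<^sup>+z. f z * ennreal (BK_kernel \<nu> x y z) \<partial>lborel) * g y"
          by (rule nn_integral_multc) measurable
        also have "\<dots> = (\<integral>\<^sup>+\<theta>. f (chord x y \<theta>) \<partial>angle_measure \<nu>) * ennreal (y powr (2 * \<nu> + 1)) * g y"
          using elim True \<nu> x by (simp add: nn_integral_angle_eq_kernel)
        finally show ?thesis
          using True by (simp add: mult_ac)
      next
        case False
        then show ?thesis using elim by (simp add: BK_kernel_def)
      qed
    qed
  qed
  finally show ?thesis .
qed

text \<open>Both sides are the same double integral against the symmetric kernel, read in the two
  orders. With values in \<open>ennreal\<close>, Tonelli applies without any integrability
  condition.\<close>

lemma BK_translation_adjoint:
  fixes f g :: "real \<Rightarrow> ennreal"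
  assumes [measurable]: "f \<in> borel_measurable borel" "g \<in> borel_measurable borel"
    and \<nu>: "\<nu> \<ge> 0" and x: "x > 0"
  shows "(\<integral>\<^sup>+y. (\<integral>\<^sup>+\<theta>. f (chord x y \<theta>) \<partial>angle_measure \<nu>) * g y \<partial>BK_haar \<nu>)
    = (\<integral>\<^sup>+z. (\<integral>\<^sup>+\<theta>. g (chord x z \<theta>) \<partial>angle_measure \<nu>) * f z \<partial>BK_haar \<nu>)"
proof -
  have [measurable]: "(\<lambda>(y, z). BK_kernel \<nu> x y z) \<in> borel_measurable (borel \<Otimes>\<^sub>M borel)"
    unfolding BK_kernel_def heron_def by measurable
  have "(\<integral>\<^sup>+y. (\<integral>\<^sup>+z. f z * g y * ennreal (BK_kernel \<nu> x y z) \<partial>lborel) \<partial>lborel)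
      = (\<integral>\<^sup>+z. (\<integral>\<^sup>+y. f z * g y * ennreal (BK_kernel \<nu> x y z) \<partial>lborel) \<partial>lborel)"
    by (rule lborel_pair.Fubini') measurable
  also have "\<dots> = (\<integral>\<^sup>+z. (\<integral>\<^sup>+y. g y * f z * ennreal (BK_kernel \<nu> x z y) \<partial>lborel) \<partial>lborel)"
    by (simp only: BK_kernel_commute[of \<nu> x z for z] mult.commute)
  finally show ?thesis
    using assms by (simp add: nn_integral_translation_eq_kernel)
qed

section \<open>The invariant mean\<close>

text \<open>By Tychonoff's theorem; this replaces Banach limits.\<close>

lemma pointwise_bounded_subconvergent:
  fixes u :: "'i \<Rightarrow> 'a \<Rightarrow> complex"
  assumes "F0 \<noteq> bot" and bound: "\<And>i a. cmod (u i a) \<le> b a"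
  obtains F L where "F \<noteq> bot" "F \<le> F0" "\<And>a. ((\<lambda>i. u i a) \<longlongrightarrow> L a) F"
proof -
  let ?K = "Pi\<^sub>E UNIV (\<lambda>a. cball (0::complex) (b a))"
  have "compactin (product_topology (\<lambda>_. euclidean) UNIV) ?K"
    unfolding compactin_PiE by simp
  then have "compact ?K"
    by (simp add: euclidean_product_topology)
  moreover have "filtermap u F0 \<noteq> bot"
    using assms(1) by (simp add: filtermap_bot_iff)
  moreover have "eventually (\<lambda>f. f \<in> ?K) (filtermap u F0)"
    using bound by (intro always_eventually[THEN eventually_filtermap[THEN iffD2]]) (simp add: PiE_iff)
  ultimately obtain L where L: "inf (nhds L) (filtermap u F0) \<noteq> bot"
    unfolding compact_filter by blast
  \<comment> \<open>Compactness yields a cluster point L in the space of functions. Pulling its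
    neighbourhoods back along u gives a filter on the indices, finer than F0, along which u
    genuinely converges.\<close>
  define F where "F = inf F0 (filtercomap u (nhds L))"
  show thesis
  proof (rule that[of F L])
    show "F \<noteq> bot"
    proof
      assume "F = bot"
      then have "eventually (\<lambda>_. False) F" by simp
      then obtain P Q where PQ: "eventually P F0" "eventually Q (nhds L)" "\<And>i. P i \<Longrightarrow> \<not> Q (u i)"
        unfolding F_def eventually_inf eventually_filtercomap by blast
      have "eventually (\<lambda>f. \<not> Q f) (filtermap u F0)"
        using eventually_mono[OF PQ(1) PQ(3)] by (simp add: eventually_filtermap)
      with PQ(2) have "eventually (\<lambda>_. False) (inf (nhds L) (filtermap u F0))"
        unfolding eventually_inf by blast
      with L show False by (simp add: trivial_limit_def)
    qed
    show "F \<le> F0" by (simp add: F_def)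
    have u: "(u \<longlongrightarrow> L) F"
      unfolding F_def by (rule filterlim_mono[OF filterlim_filtercomap order_refl inf_le2])
    show "((\<lambda>i. u i a) \<longlongrightarrow> L a) F" for a
    proof (rule topological_tendstoI)
      fix S assume S: "open S" "L a \<in> S"
      have "open ((\<lambda>f. f a) -` S)"
        by (rule open_vimage[OF S(1) continuous_on_product_coordinates])
      from topological_tendstoD[OF u this] S(2) show "\<forall>\<^sub>F i in F. u i a \<in> S" by simp
    qed
  qed
qed

section \<open>Haar measure of intervals\<close>

lemma emeasure_BK_haar_Icc:
  assumes \<nu>: "\<nu> \<ge> 0" and ab: "0 \<le> a" "a \<le> b"
  shows "emeasure (BK_haar \<nu>) {a..b} =
    ennreal ((b powr (2 * \<nu> + 2) - a powr (2 * \<nu> + 2)) / (2 * \<nu> + 2))"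
proof -
  let ?p = "2 * \<nu> + 2"
  have "{a..b} \<in> sets (BK_haar \<nu>)"
    using ab by (auto simp: sets_BK_haar sets_restrict_space_iff)
  then have "emeasure (BK_haar \<nu>) {a..b} = (\<integral>\<^sup>+x. indicator {a..b} x \<partial>BK_haar \<nu>)"
    by simp
  also have "\<dots> = (\<integral>\<^sup>+x. indicator {a..b} x * ennreal (x powr (2 * \<nu> + 1)) * indicator {0..} x \<partial>lborel)"
    by (rule nn_integral_BK_haar) simp
  also have "\<dots> = (\<integral>\<^sup>+x. ennreal (x powr (2 * \<nu> + 1)) * indicator {a..b} x \<partial>lborel)"
    using ab by (intro nn_integral_cong) (auto split: split_indicator)
  also have "\<dots> = ennreal (b powr ?p / ?p - a powr ?p / ?p)"
  proof (rule nn_integral_has_integral_lebesgue')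
    show "((\<lambda>x. x powr (2 * \<nu> + 1)) has_integral b powr ?p / ?p - a powr ?p / ?p) {a..b}"
    proof (rule fundamental_theorem_of_calculus_interior)
      show "continuous_on {a..b} (\<lambda>x. x powr ?p / ?p)"
        using ab \<nu> by (intro continuous_intros continuous_on_powr') auto
      fix x assume "x \<in> {a<..<b}"
      then have "((\<lambda>x. x powr ?p / ?p) has_real_derivative x powr (2 * \<nu> + 1)) (at x)"
        using ab \<nu> by (auto intro!: derivative_eq_intros simp: add.commute)
      then show "((\<lambda>x. x powr ?p / ?p) has_vector_derivative x powr (2 * \<nu> + 1)) (at x)"
        by (simp add: has_real_derivative_iff_has_vector_derivative)
    qed (use ab in auto)
  qed simp
  finally show ?thesis by (simp add: diff_divide_distrib)
qed

lemma measure_BK_haar_Icc: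
  assumes \<nu>: "\<nu> \<ge> 0" and ab: "0 \<le> a" "a \<le> b"
  shows "measure (BK_haar \<nu>) {a..b} = (b powr (2 * \<nu> + 2) - a powr (2 * \<nu> + 2)) / (2 * \<nu> + 2)"
  unfolding measure_def emeasure_BK_haar_Icc[OF assms]
  using assms powr_mono2[of "2 * \<nu> + 2" a b] by simp

lemma Icc_sets_BK_haar: "0 \<le> a \<Longrightarrow> {a..b} \<in> sets (BK_haar \<nu>)"
  by (auto simp: sets_BK_haar sets_restrict_space_iff)

lemma emeasure_BK_haar_Icc_finite:
  assumes "\<nu> \<ge> 0" and "0 \<le> a"
  shows "emeasure (BK_haar \<nu>) {a..b} < \<infinity>"
  using assms by (cases "a \<le> b") (auto simp: emeasure_BK_haar_Icc)

lemma sets_BK_haar_imp_borel: "A \<in> sets (BK_haar \<nu>) \<Longrightarrow> A \<in> sets borel"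
  by (simp add: sets_BK_haar sets_restrict_space_iff)

section \<open>Translation of essentially bounded functions\<close>

lemma chord_0 [simp]: "chord 0 y \<theta> = \<bar>y\<bar>"
  by (simp add: chord_def)

lemma chord_bounds:
  assumes "x \<ge> 0" "y \<ge> 0"
  shows "\<bar>x - y\<bar> \<le> chord x y \<theta>" "chord x y \<theta> \<le> x + y"
proof -
  have "x * y * cos \<theta> \<le> x * y * 1" "x * y * (- 1) \<le> x * y * cos \<theta>"
    using assms by (intro mult_left_mono; simp)+
  then have "(x - y)\<^sup>2 \<le> (chord x y \<theta>)\<^sup>2" "(chord x y \<theta>)\<^sup>2 \<le> (x + y)\<^sup>2"
    unfolding chord_square power2_diff power2_sum by linarith+
  then show "\<bar>x - y\<bar> \<le> chord x y \<theta>" "chord x y \<theta> \<le> x + y"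
    using abs_le_square_iff[of "x - y" "chord x y \<theta>"] abs_le_square_iff[of "chord x y \<theta>" "x + y"] assms
    by auto
qed

text \<open>Adjointness applied to the indicator of A and the constant 1: the Haar integral over y
  of the mass that the convolution of x and y gives to A is the Haar measure of A. For x = 0 the
  convolution is a point mass, which \<open>translation_0\<close> treats.\<close>

lemma AE_translation_null:
  assumes \<nu>: "\<nu> \<ge> 0" and x: "x > 0" and A: "A \<in> null_sets (BK_haar \<nu>)"
  shows "AE y in BK_haar \<nu>. AE \<theta> in angle_measure \<nu>. chord x y \<theta> \<notin> A"
proof -
  have b[measurable]: "A \<in> sets borel"
    using A by (auto intro: sets_BK_haar_imp_borel)
  have "(\<integral>\<^sup>+y. (\<integral>\<^sup>+\<theta>. indicator A (chord x y \<theta>) \<partial>angle_measure \<nu>) * 1 \<partial>BK_haar \<nu>)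
      = (\<integral>\<^sup>+z. (\<integral>\<^sup>+\<theta>. 1 \<partial>angle_measure \<nu>) * indicator A z \<partial>BK_haar \<nu>)"
    by (rule BK_translation_adjoint[OF _ _ \<nu> x]) auto
  also have "\<dots> = 0"
    using null_setsD1[OF A] null_setsD2[OF A] prob_space.emeasure_space_1[OF prob_space_angle_measure[OF \<nu>]]
    by simp
  finally have "(\<integral>\<^sup>+y. (\<integral>\<^sup>+\<theta>. indicator A (chord x y \<theta>) \<partial>angle_measure \<nu>) \<partial>BK_haar \<nu>) = 0"
    by simp
  moreover have "(\<lambda>y. \<integral>\<^sup>+\<theta>. indicator A (chord x y \<theta>) \<partial>angle_measure \<nu>) \<in> borel_measurable (BK_haar \<nu>)"
    unfolding borel_measurable_BK_haar
    by (intro measurable_restrict_space1 borel_measurable_nn_integral_chord \<nu>) auto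
  ultimately have "AE y in BK_haar \<nu>. (\<integral>\<^sup>+\<theta>. indicator A (chord x y \<theta>) \<partial>angle_measure \<nu>) = 0"
    by (subst (asm) nn_integral_0_iff_AE)
  then show ?thesis
  proof eventually_elim
    case (elim y)
    have "(\<lambda>\<theta>. indicator A (chord x y \<theta>) :: ennreal) \<in> borel_measurable (angle_measure \<nu>)"
      unfolding measurable_cong_sets[OF sets_angle_measure refl]
      by (intro measurable_restrict_space1) measurable
    from nn_integral_0_iff_AE[OF this] elim
    have "AE \<theta> in angle_measure \<nu>. indicator A (chord x y \<theta>) = (0::ennreal)" by simp
    then show ?case by eventually_elim (simp add: indicator_eq_0_iff)
  qed
qed

lemma measurable_chord_pair_BK:
  "(\<lambda>p. chord x (fst p) (snd p)) \<in> BK_haar \<nu> \<Otimes>\<^sub>M angle_measure \<nu> \<rightarrow>\<^sub>M restrict_space borel {0..}"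
proof (rule measurable_restrict_space2)
  show "(\<lambda>p. chord x (fst p) (snd p)) \<in> borel_measurable (BK_haar \<nu> \<Otimes>\<^sub>M angle_measure \<nu>)"
    by (rule measurable_chord_pair) (simp add: borel_measurable_BK_haar measurable_restrict_space1)
qed simp

lemma translation_measurable:
  assumes \<nu>: "\<nu> \<ge> 0" and f: "f \<in> borel_measurable (BK_haar \<nu>)"
  shows "translation (BK_conv \<nu>) x f \<in> borel_measurable (BK_haar \<nu>)"
proof -
  interpret prob_space "angle_measure \<nu>" by (rule prob_space_angle_measure[OF \<nu>])
  have f': "f \<in> borel_measurable (restrict_space borel {0..})"
    using f by (simp add: borel_measurable_BK_haar)
  have "(\<lambda>y. \<integral>\<theta>. f (chord x y \<theta>) \<partial>angle_measure \<nu>) \<in> borel_measurable (BK_haar \<nu>)"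
    using measurable_compose[OF measurable_chord_pair_BK f']
    by (intro borel_measurable_lebesgue_integral) (simp add: case_prod_beta)
  then show ?thesis
    by (simp add: translation_BK_conv[OF f', abs_def])
qed

lemma translation_0:
  assumes \<nu>: "\<nu> \<ge> 0" and f: "f \<in> borel_measurable (BK_haar \<nu>)" and y: "y \<ge> 0"
  shows "translation (BK_conv \<nu>) 0 f y = f y"
proof -
  interpret prob_space "angle_measure \<nu>" by (rule prob_space_angle_measure[OF \<nu>])
  show ?thesis
    using f y prob_space by (simp add: translation_BK_conv borel_measurable_BK_haar)
qed

text \<open>The set where f exceeds C is null, so for almost every y the convolution does not charge
  it, and averaging against a probability measure preserves the bound.\<close>

lemma AE_translation_bound:
  assumes \<nu>: "\<nu> \<ge> 0" and x: "x \<ge> 0" and f: "f \<in> borel_measurable (BK_haar \<nu>)"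
    and C: "AE y in BK_haar \<nu>. cmod (f y) \<le> C"
  shows "AE y in BK_haar \<nu>. cmod (translation (BK_conv \<nu>) x f y) \<le> C"
proof (cases "x = 0")
  case True
  show ?thesis using C AE_space
    by eventually_elim (use True translation_0[OF \<nu> f] in auto)
next
  case False
  interpret prob_space "angle_measure \<nu>" by (rule prob_space_angle_measure[OF \<nu>])
  have f': "f \<in> borel_measurable (restrict_space borel {0..})"
    using f by (simp add: borel_measurable_BK_haar)
  let ?A = "{y \<in> space (BK_haar \<nu>). \<not> cmod (f y) \<le> C}"
  have "?A \<in> sets (BK_haar \<nu>)" using f by measurable
  with C have "?A \<in> null_sets (BK_haar \<nu>)"
    by (simp add: AE_iff_null)
  with AE_translation_null[OF \<nu> _ this, of x] x False
  have "AE y in BK_haar \<nu>. AE \<theta> in angle_measure \<nu>. chord x y \<theta> \<notin> ?A" by simp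
  then show ?thesis
  proof eventually_elim
    case (elim y)
    then have b: "AE \<theta> in angle_measure \<nu>. cmod (f (chord x y \<theta>)) \<le> C"
      by eventually_elim auto
    have "integrable (angle_measure \<nu>) (\<lambda>\<theta>. f (chord x y \<theta>))"
      using b measurable_compose[OF measurable_chord f'] by (intro integrable_const_bound[of _ C]) auto
    then have "cmod (\<integral>\<theta>. f (chord x y \<theta>) \<partial>angle_measure \<nu>) \<le> (\<integral>\<theta>. C \<partial>angle_measure \<nu>)"
      using b by (intro order_trans[OF integral_norm_bound] integral_mono_AE) auto
    then show ?case
      using prob_space by (simp add: translation_BK_conv[OF f'])
  qed
qed

lemma translation_Linfty:
  assumes \<nu>: "\<nu> \<ge> 0" and x: "x \<ge> 0" and f: "f \<in> Linfty (BK_haar \<nu>)"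
  shows "translation (BK_conv \<nu>) x f \<in> Linfty (BK_haar \<nu>)"
proof -
  obtain C where "C \<ge> 0" "AE y in BK_haar \<nu>. cmod (f y) \<le> C"
    by (rule Linfty_obtain_bound[OF f])
  then show ?thesis
    using AE_translation_bound[OF \<nu> x Linfty_measurable[OF f], of C]
      translation_measurable[OF \<nu> Linfty_measurable[OF f]]
    by (intro Linfty_I(1)[of _ _ C])
qed

section \<open>Translates of the indicator of [0, R]\<close>

definition disc_translate :: "real \<Rightarrow> real \<Rightarrow> real \<Rightarrow> real \<Rightarrow> real" where
  "disc_translate \<nu> R x z = enn2real (\<integral>\<^sup>+\<theta>. indicator {0..R} (chord x z \<theta>) \<partial>angle_measure \<nu>)"

lemma nn_integral_disc_le_1:
  assumes \<nu>: "\<nu> \<ge> 0"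
  shows "(\<integral>\<^sup>+\<theta>. indicator {0..R} (chord x z \<theta>) \<partial>angle_measure \<nu>) \<le> 1"
proof -
  have "(\<integral>\<^sup>+\<theta>. indicator {0..R} (chord x z \<theta>) \<partial>angle_measure \<nu>) \<le> (\<integral>\<^sup>+\<theta>. 1 \<partial>angle_measure \<nu>)"
    by (intro nn_integral_mono) (auto split: split_indicator)
  then show ?thesis
    using prob_space.emeasure_space_1[OF prob_space_angle_measure[OF \<nu>]] by simp
qed

lemma ennreal_disc_translate:
  assumes \<nu>: "\<nu> \<ge> 0"
  shows "ennreal (disc_translate \<nu> R x z) = (\<integral>\<^sup>+\<theta>. indicator {0..R} (chord x z \<theta>) \<partial>angle_measure \<nu>)"
  unfolding disc_translate_def using nn_integral_disc_le_1[OF \<nu>, of R x z]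
  by (intro ennreal_enn2real) (auto simp: less_top intro: le_less_trans)

lemma disc_translate_bounds:
  assumes "\<nu> \<ge> 0"
  shows "0 \<le> disc_translate \<nu> R x z" "disc_translate \<nu> R x z \<le> 1"
  using nn_integral_disc_le_1[OF assms, of R x z]
  by (auto simp: disc_translate_def intro: enn2real_leI)

lemma disc_translate_measurable [measurable]:
  assumes "\<nu> \<ge> 0"
  shows "disc_translate \<nu> R x \<in> borel_measurable borel"
  unfolding disc_translate_def[abs_def]
  using borel_measurable_nn_integral_chord[OF assms, of "indicator {0..R}" x] by measurable

lemma disc_translate_eq_1:
  assumes \<nu>: "\<nu> \<ge> 0" and "x \<ge> 0" "z \<ge> 0" "x + z \<le> R"
  shows "disc_translate \<nu> R x z = 1"
proof -
  have "chord x z \<theta> \<in> {0..R}" for \<theta>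
    using chord_bounds(2)[of x z \<theta>] assms by simp
  then show ?thesis
    using prob_space.emeasure_space_1[OF prob_space_angle_measure[OF \<nu>]]
    by (simp add: disc_translate_def)
qed

lemma disc_translate_eq_0:
  assumes "x \<ge> 0" "z > R + x" "R \<ge> 0"
  shows "disc_translate \<nu> R x z = 0"
proof -
  have "chord x z \<theta> \<notin> {0..R}" for \<theta>
    using chord_bounds(1)[of x z \<theta>] assms by auto
  then show ?thesis
    by (simp add: disc_translate_def)
qed

lemma measurable_chord_pair_density:
  "(\<lambda>p. chord x (fst p) (snd p)) \<in>
    density (BK_haar \<nu>) g \<Otimes>\<^sub>M angle_measure \<nu> \<rightarrow>\<^sub>M BK_haar \<nu>"
proof -
  have "sets (density (BK_haar \<nu>) g \<Otimes>\<^sub>M angle_measure \<nu>) = sets (BK_haar \<nu> \<Otimes>\<^sub>M angle_measure \<nu>)"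
    by (intro sets_pair_measure_cong) auto
  then show ?thesis
    using measurable_chord_pair_BK[of x \<nu>] by (simp add: measurable_cong_sets[OF _ sets_BK_haar])
qed

text \<open>Adjointness as an identity of measures. In this form the transformation rules for
  push-forwards and densities carry it from nonnegative to complex functions.\<close>

lemma distr_chord_eq_density:
  assumes \<nu>: "\<nu> \<ge> 0" and x: "x > 0" and R: "R \<ge> 0"
  shows "distr (density (BK_haar \<nu>) (indicator {0..R}) \<Otimes>\<^sub>M angle_measure \<nu>) (BK_haar \<nu>)
      (\<lambda>p. chord x (fst p) (snd p))
    = density (BK_haar \<nu>) (\<lambda>z. ennreal (disc_translate \<nu> R x z))"
    (is "distr (?N \<Otimes>\<^sub>M _) ?M ?\<phi> = _")
proof (rule measure_eqI)
  interpret prob_space "angle_measure \<nu>" by (rule prob_space_angle_measure[OF \<nu>])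
  have \<phi>: "?\<phi> \<in> ?N \<Otimes>\<^sub>M angle_measure \<nu> \<rightarrow>\<^sub>M ?M"
    by (rule measurable_chord_pair_density)
  fix X assume "X \<in> sets (distr (?N \<Otimes>\<^sub>M angle_measure \<nu>) ?M ?\<phi>)"
  then have X: "X \<in> sets ?M" by simp
  then have Xb[measurable]: "X \<in> sets borel" by (rule sets_BK_haar_imp_borel)
  have B: "{0..R} \<in> sets ?M" by (rule Icc_sets_BK_haar) simp
  have m: "(\<lambda>y. \<integral>\<^sup>+\<theta>. indicator X (chord x y \<theta>) \<partial>angle_measure \<nu>) \<in> borel_measurable ?M"
    unfolding borel_measurable_BK_haar
    by (intro measurable_restrict_space1 borel_measurable_nn_integral_chord \<nu>) measurable
  have "emeasure (distr (?N \<Otimes>\<^sub>M angle_measure \<nu>) ?M ?\<phi>) X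
      = (\<integral>\<^sup>+z. indicator X z \<partial>distr (?N \<Otimes>\<^sub>M angle_measure \<nu>) ?M ?\<phi>)"
    using X by simp
  also have "\<dots> = (\<integral>\<^sup>+p. indicator X (?\<phi> p) \<partial>(?N \<Otimes>\<^sub>M angle_measure \<nu>))"
    using X by (intro nn_integral_distr[OF \<phi>]) auto
  also have "\<dots> = (\<integral>\<^sup>+y. \<integral>\<^sup>+\<theta>. indicator X (chord x y \<theta>) \<partial>angle_measure \<nu> \<partial>?N)"
    using measurable_compose[OF \<phi> borel_measurable_indicator[OF X]]
    by (subst nn_integral_fst[symmetric]) auto
  also have "\<dots> = (\<integral>\<^sup>+y. indicator {0..R} y * (\<integral>\<^sup>+\<theta>. indicator X (chord x y \<theta>) \<partial>angle_measure \<nu>) \<partial>?M)"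
    using B m by (intro nn_integral_density) auto
  also have "\<dots> = (\<integral>\<^sup>+y. (\<integral>\<^sup>+\<theta>. indicator X (chord x y \<theta>) \<partial>angle_measure \<nu>) * indicator {0..R} y \<partial>?M)"
    by (simp add: mult.commute)
  also have "\<dots> = (\<integral>\<^sup>+z. (\<integral>\<^sup>+\<theta>. indicator {0..R} (chord x z \<theta>) \<partial>angle_measure \<nu>) * indicator X z \<partial>?M)"
    by (rule BK_translation_adjoint[OF _ _ \<nu> x]) measurable
  also have "\<dots> = emeasure (density ?M (\<lambda>z. ennreal (disc_translate \<nu> R x z))) X"
    unfolding ennreal_disc_translate[OF \<nu>, symmetric]
    using X disc_translate_measurable[OF \<nu>, of R x]
    by (subst emeasure_density) (auto simp: borel_measurable_BK_haar intro!: measurable_restrict_space1)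
  finally show "emeasure (distr (?N \<Otimes>\<^sub>M angle_measure \<nu>) ?M ?\<phi>) X
    = emeasure (density ?M (\<lambda>z. ennreal (disc_translate \<nu> R x z))) X" .
qed simp

lemma integrable_Icc_BK_haar:
  assumes "\<nu> \<ge> 0" and "a \<ge> 0" and "f \<in> borel_measurable (BK_haar \<nu>)"
    and "AE y in BK_haar \<nu>. cmod (f y) \<le> C"
  shows "integrable (BK_haar \<nu>) (\<lambda>y. indicator {a..b} y *\<^sub>R f y)"
  using assms(3,4)
  by (intro integrableI_bounded_set_indicator[of _ _ _ C] Icc_sets_BK_haar
      emeasure_BK_haar_Icc_finite assms(1,2)) auto

text \<open>Moves translation from f onto the indicator of [0, R]. Integrability of f against the
  translated indicator passes through the measure identity to the product space, which permits
  Fubini.\<close>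

lemma integral_translation_disc:
  assumes \<nu>: "\<nu> \<ge> 0" and x: "x > 0" and R: "R \<ge> 0"
    and f: "f \<in> borel_measurable (BK_haar \<nu>)" and C: "AE y in BK_haar \<nu>. cmod (f y) \<le> C"
  shows "integrable (BK_haar \<nu>) (\<lambda>z. disc_translate \<nu> R x z *\<^sub>R f z)"
    and "(LINT y:{0..R}|BK_haar \<nu>. translation (BK_conv \<nu>) x f y)
      = (\<integral>z. disc_translate \<nu> R x z *\<^sub>R f z \<partial>BK_haar \<nu>)"
proof -
  let ?M = "BK_haar \<nu>" and ?t = "disc_translate \<nu> R x"
  let ?N = "density ?M (indicator {0..R})" and ?\<phi> = "\<lambda>p. chord x (fst p) (snd p)"
  interpret A: prob_space "angle_measure \<nu>" by (rule prob_space_angle_measure[OF \<nu>])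
  have B: "{0..R} \<in> sets ?M" by (rule Icc_sets_BK_haar) simp
  interpret N: finite_measure ?N
  proof (rule finite_measureI)
    have "emeasure ?N (space ?N) = emeasure ?M ({0..R} \<inter> space ?M)"
      using emeasure_restricted[OF B sets.top] by simp
    also have "{0..R} \<inter> space ?M = {0..R}" by auto
    finally show "emeasure ?N (space ?N) \<noteq> \<infinity>"
      using emeasure_BK_haar_Icc_finite[OF \<nu>, of 0 R] by simp
  qed
  interpret NA: pair_sigma_finite ?N "angle_measure \<nu>" ..
  have t: "?t \<in> borel_measurable ?M"
    unfolding borel_measurable_BK_haar by (intro measurable_restrict_space1 disc_translate_measurable \<nu>)
  \<comment> \<open>f need not be integrable, but the translated indicator vanishes beyond R + x, so
    the cut-off changes nothing and confines the product to finite measure.\<close>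
  have "integrable ?M (\<lambda>z. indicator {0..R + x} z *\<^sub>R (?t z *\<^sub>R f z))"
  proof (rule integrable_Icc_BK_haar[OF \<nu>, of _ _ C])
    show "AE z in ?M. cmod (?t z *\<^sub>R f z) \<le> C"
      using C
    proof eventually_elim
      case (elim z)
      have "cmod (?t z *\<^sub>R f z) \<le> 1 * cmod (f z)"
        using disc_translate_bounds[OF \<nu>, of R x z] by (simp add: mult_left_le_one_le)
      with elim show ?case by simp
    qed
  qed (use f t in auto)
  also have "?this \<longleftrightarrow> integrable ?M (\<lambda>z. ?t z *\<^sub>R f z)"
    using x R by (intro Bochner_Integration.integrable_cong)
      (auto simp: disc_translate_eq_0 split: split_indicator)
  finally show int: "integrable ?M (\<lambda>z. ?t z *\<^sub>R f z)" .
  have t0: "AE z in ?M. 0 \<le> ?t z"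
    using disc_translate_bounds[OF \<nu>] by simp
  have \<phi>: "?\<phi> \<in> ?N \<Otimes>\<^sub>M angle_measure \<nu> \<rightarrow>\<^sub>M ?M"
    by (rule measurable_chord_pair_density)
  have f': "f \<in> borel_measurable (restrict_space borel {0..})"
    using f by (simp add: borel_measurable_BK_haar)
  have "integrable (density ?M (\<lambda>z. ennreal (?t z))) f"
    using int by (subst integrable_density[OF f t t0])
  then have iP: "integrable (?N \<Otimes>\<^sub>M angle_measure \<nu>) (\<lambda>p. f (?\<phi> p))"
    using \<phi> f by (simp add: integrable_distr_eq flip: distr_chord_eq_density[OF \<nu> x R])
  have "(LINT y:{0..R}|?M. translation (BK_conv \<nu>) x f y) = (\<integral>y. translation (BK_conv \<nu>) x f y \<partial>?N)"
  proof -
    have "?N = density ?M (\<lambda>y. ennreal (indicator {0..R} y))"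
      by (simp add: ennreal_indicator)
    then show ?thesis
      using B translation_measurable[OF \<nu> f, of x] unfolding set_lebesgue_integral_def
      by (simp add: integral_density)
  qed
  also have "\<dots> = (\<integral>y. (\<integral>\<theta>. f (?\<phi> (y, \<theta>)) \<partial>angle_measure \<nu>) \<partial>?N)"
    by (simp add: translation_BK_conv[OF f'])
  also have "\<dots> = (\<integral>p. f (?\<phi> p) \<partial>(?N \<Otimes>\<^sub>M angle_measure \<nu>))"
    by (rule NA.integral_fst'[OF iP])
  also have "\<dots> = (\<integral>z. f z \<partial>distr (?N \<Otimes>\<^sub>M angle_measure \<nu>) ?M ?\<phi>)"
    by (rule integral_distr[OF \<phi> f, symmetric])
  also have "\<dots> = (\<integral>z. ?t z *\<^sub>R f z \<partial>?M)"
    unfolding distr_chord_eq_density[OF \<nu> x R] by (rule integral_density[OF f t t0])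
  finally show "(LINT y:{0..R}|?M. translation (BK_conv \<nu>) x f y) = (\<integral>z. ?t z *\<^sub>R f z \<partial>?M)" .
qed

text \<open>Translating by \<open>x\<close> only changes the indicator of \<open>[0, R]\<close> on \<open>[R - x, R + x]\<close>.\<close>

lemma translation_average_diff:
  assumes \<nu>: "\<nu> \<ge> 0" and x: "x > 0" and R: "R \<ge> x"
    and f: "f \<in> borel_measurable (BK_haar \<nu>)" and C: "AE y in BK_haar \<nu>. cmod (f y) \<le> C" "C \<ge> 0"
  shows "cmod ((LINT y:{0..R}|BK_haar \<nu>. translation (BK_conv \<nu>) x f y) - (LINT y:{0..R}|BK_haar \<nu>. f y))
    \<le> C * measure (BK_haar \<nu>) {R - x..R + x}"
proof -
  let ?M = "BK_haar \<nu>" and ?t = "disc_translate \<nu> R x" and ?S = "{R - x..R + x}"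
  have R0: "R \<ge> 0" using x R by simp
  have S: "?S \<in> sets ?M" "emeasure ?M ?S < \<infinity>"
    using R Icc_sets_BK_haar[of "R - x"] emeasure_BK_haar_Icc_finite[OF \<nu>, of "R - x"] by simp_all
  note i1 = integral_translation_disc(1)[OF \<nu> x R0 f C(1)]
  have i2: "integrable ?M (\<lambda>y. indicator {0..R} y *\<^sub>R f y)"
    by (rule integrable_Icc_BK_haar[OF \<nu> _ f C(1)]) simp
  have "(LINT y:{0..R}|?M. translation (BK_conv \<nu>) x f y) - (LINT y:{0..R}|?M. f y)
      = (\<integral>z. ?t z *\<^sub>R f z - indicator {0..R} z *\<^sub>R f z \<partial>?M)"
    unfolding integral_translation_disc(2)[OF \<nu> x R0 f C(1)]
    unfolding set_lebesgue_integral_def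
    by (rule Bochner_Integration.integral_diff[OF i1 i2, symmetric])
  also have "cmod \<dots> \<le> (\<integral>z. cmod (?t z *\<^sub>R f z - indicator {0..R} z *\<^sub>R f z) \<partial>?M)"
    by (rule integral_norm_bound)
  also have "\<dots> \<le> (\<integral>z. C * indicator ?S z \<partial>?M)"
  proof (rule integral_mono_AE)
    show "integrable ?M (\<lambda>z. cmod (?t z *\<^sub>R f z - indicator {0..R} z *\<^sub>R f z))"
      by (intro integrable_norm Bochner_Integration.integrable_diff i1 i2)
    show "integrable ?M (\<lambda>z. C * indicator ?S z)"
      using S by (intro integrable_mult_right integrable_real_indicator)
    show "AE z in ?M. cmod (?t z *\<^sub>R f z - indicator {0..R} z *\<^sub>R f z) \<le> C * indicator ?S z"
      using C(1) AE_space
    proof eventually_elim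
      case (elim z)
      have "cmod (?t z *\<^sub>R f z - indicator {0..R} z *\<^sub>R f z) = \<bar>?t z - indicator {0..R} z\<bar> * cmod (f z)"
        by (simp flip: scaleR_left_diff_distrib)
      also have "\<dots> \<le> indicator ?S z * C"
      proof (rule mult_mono)
        \<comment> \<open>Below R - x both terms are 1 and above R + x both are 0, by the triangle
          inequality; in between they lie in [0, 1].\<close>
        show "\<bar>?t z - indicator {0..R} z\<bar> \<le> indicator ?S z"
          using disc_translate_bounds[OF \<nu>, of R x z] disc_translate_eq_1[OF \<nu>, of x z R]
            disc_translate_eq_0[of x R z \<nu>] x R R0 elim(2)
          by (auto split: split_indicator)
      qed (use elim in auto)
      finally show ?case by (simp add: mult.commute)
    qed
  qed
  also have "\<dots> = C * measure ?M ?S"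
    using S R by (simp add: max_def)
  finally show ?thesis .
qed

text \<open>By homogeneity of the Haar measure the ratio is (1 + x/R)^p - (1 - x/R)^p with p =
  2\<nu> + 2, and x/R tends to 0.\<close>

lemma annulus_ratio_tendsto_0:
  assumes \<nu>: "\<nu> \<ge> 0" and x: "x > 0"
  shows "((\<lambda>R. measure (BK_haar \<nu>) {R - x..R + x} / measure (BK_haar \<nu>) {0..R}) \<longlongrightarrow> 0) at_top"
proof -
  let ?p = "2 * \<nu> + 2"
  have "((\<lambda>R::real. x / R) \<longlongrightarrow> 0) at_top"
    by (intro tendsto_divide_0[OF tendsto_const] filterlim_at_top_imp_at_infinity filterlim_ident)
  then have "((\<lambda>R. (1 + x / R) powr ?p - (1 - x / R) powr ?p) \<longlongrightarrow> (1 + 0) powr ?p - (1 - 0) powr ?p) at_top"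
    by (intro tendsto_intros) auto
  moreover have "\<forall>\<^sub>F R in at_top. (1 + x / R) powr ?p - (1 - x / R) powr ?p
      = measure (BK_haar \<nu>) {R - x..R + x} / measure (BK_haar \<nu>) {0..R}"
    using eventually_ge_at_top[of x]
  proof eventually_elim
    case (elim R)
    then have R: "R > 0" using x by simp
    have e: "1 + x / R = (R + x) / R" "1 - x / R = (R - x) / R"
      using R by (simp_all add: field_simps)
    have "measure (BK_haar \<nu>) {R - x..R + x} = ((R + x) powr ?p - (R - x) powr ?p) / ?p"
      using elim x by (intro measure_BK_haar_Icc[OF \<nu>]) auto
    moreover have "measure (BK_haar \<nu>) {0..R} = R powr ?p / ?p"
      using R by (subst measure_BK_haar_Icc[OF \<nu>]) auto
    ultimately show ?case
      unfolding e powr_divide diff_divide_distrib[symmetric] using \<nu> by simp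
  qed
  ultimately show ?thesis
    by (auto dest: tendsto_cong)
qed

section \<open>Averages over [0, R] and their limit\<close>

definition BK_average :: "real \<Rightarrow> real \<Rightarrow> (real \<Rightarrow> complex) \<Rightarrow> complex" where
  "BK_average \<nu> R f = (LINT y:{0..R}|BK_haar \<nu>. f y) / measure (BK_haar \<nu>) {0..R}"

text \<open>The compactness argument needs a bound uniform in all real R. If [0, R] has mass 0, as
  for R \<le> 0, division by 0 makes the average 0.\<close>

lemma BK_average_norm_le:
  assumes \<nu>: "\<nu> \<ge> 0" and f: "f \<in> borel_measurable (BK_haar \<nu>)"
    and C: "AE y in BK_haar \<nu>. cmod (f y) \<le> C" "C \<ge> 0"
  shows "cmod (BK_average \<nu> R f) \<le> C"
proof -
  let ?M = "BK_haar \<nu>"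
  have S: "{0..R} \<in> sets ?M" "emeasure ?M {0..R} < \<infinity>"
    using Icc_sets_BK_haar[of 0] emeasure_BK_haar_Icc_finite[OF \<nu>, of 0] by simp_all
  have i: "integrable ?M (\<lambda>y. indicator {0..R} y *\<^sub>R f y)"
    by (rule integrable_Icc_BK_haar[OF \<nu> _ f C(1)]) simp
  have "cmod (LINT y:{0..R}|?M. f y) \<le> (\<integral>y. cmod (indicator {0..R} y *\<^sub>R f y) \<partial>?M)"
    unfolding set_lebesgue_integral_def by (rule integral_norm_bound)
  also have "\<dots> \<le> (\<integral>y. C * indicator {0..R} y \<partial>?M)"
  proof (rule integral_mono_AE)
    show "integrable ?M (\<lambda>z. C * indicator {0..R} z)"
      using S by (intro integrable_mult_right integrable_real_indicator)
    show "AE y in ?M. cmod (indicator {0..R} y *\<^sub>R f y) \<le> C * indicator {0..R} y"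
      using C(1) by eventually_elim (auto split: split_indicator)
  qed (rule integrable_norm[OF i])
  also have "\<dots> = C * measure ?M {0..R}"
    using S by simp
  finally show ?thesis
    using C(2) by (cases "measure ?M {0..R} = 0")
      (auto simp: BK_average_def norm_divide divide_le_eq zero_less_measure_iff less_le)
qed

lemma measure_BK_haar_disc_pos: "\<nu> \<ge> 0 \<Longrightarrow> R > 0 \<Longrightarrow> measure (BK_haar \<nu>) {0..R} > 0"
  by (subst measure_BK_haar_Icc) auto

lemma BK_amenable:
  assumes \<nu>: "\<nu> \<ge> 0" and l: "l \<ge> 0" and one: "\<And>x. x \<ge> 0 \<Longrightarrow> BK_char \<nu> l x = 1"
  shows "alpha_amenable (BK_haar \<nu>) (BK_conv \<nu>) (BK_char \<nu> l)"
proof -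
  let ?M = "BK_haar \<nu>" and ?T = "translation (BK_conv \<nu>)"
  \<comment> \<open>The product space is indexed by all functions, so the averages are set to 0 off
    \<open>Linfty\<close> to be bounded at every index.\<close>
  define u where "u R f = (if f \<in> Linfty ?M then BK_average \<nu> R f else 0)" for R f
  have u: "u R f = BK_average \<nu> R f" if "f \<in> Linfty ?M" for R f
    using that by (simp add: u_def)
  have bound: "cmod (u R f) \<le> (if f \<in> Linfty ?M then Linfty_norm ?M f else 0)" for R f
    using BK_average_norm_le[OF \<nu> Linfty_measurable AE_Linfty_norm Linfty_norm_nonneg, of f R]
    by (simp add: u_def)
  have "(at_top :: real filter) \<noteq> bot" by simp
  from pointwise_bounded_subconvergent[of at_top u, OF this bound] obtain F m
    where F: "F \<noteq> bot" "F \<le> at_top" and m: "\<And>f. ((\<lambda>R. u R f) \<longlongrightarrow> m f) F"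
    by blast
  have int: "set_integrable ?M {0..R} f" if f: "f \<in> Linfty ?M" for f R
    unfolding set_integrable_def
    by (rule integrable_Icc_BK_haar[OF \<nu> _ Linfty_measurable[OF f] AE_Linfty_norm[OF f]]) simp
  have "Linfty_functional ?M m"
    unfolding Linfty_functional_def
  proof (intro conjI ballI allI exI[of _ 1])
    fix f g assume fg: "f \<in> Linfty ?M" "g \<in> Linfty ?M"
    have "u R (\<lambda>x. f x + g x) = u R f + u R g" for R
      using int[OF fg(1)] int[OF fg(2)]
      by (simp add: u fg Linfty_add BK_average_def set_integral_add add_divide_distrib)
    with m[of "\<lambda>x. f x + g x"] have "((\<lambda>R. u R f + u R g) \<longlongrightarrow> m (\<lambda>x. f x + g x)) F"
      by simp
    from tendsto_unique[OF F(1) this tendsto_add[OF m m]]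
    show "m (\<lambda>x. f x + g x) = m f + m g" .
  next
    fix c f assume f: "f \<in> Linfty ?M"
    have "u R (\<lambda>x. c * f x) = c * u R f" for R
      by (simp add: u f Linfty_cmult BK_average_def)
    with m[of "\<lambda>x. c * f x"] have "((\<lambda>R. c * u R f) \<longlongrightarrow> m (\<lambda>x. c * f x)) F"
      by simp
    from tendsto_unique[OF F(1) this tendsto_mult[OF tendsto_const m]]
    show "m (\<lambda>x. c * f x) = c * m f" .
  next
    fix f assume f: "f \<in> Linfty ?M"
    have "cmod (m f) \<le> Linfty_norm ?M f"
      using bound[of _ f] f by (intro tendsto_upperbound[OF tendsto_norm[OF m] _ F(1)] always_eventually) simp
    then show "cmod (m f) \<le> 1 * Linfty_norm ?M f" by simp
  qed
  moreover have "m (BK_char \<nu> l) = 1"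
  proof -
    have "u R (BK_char \<nu> l) = 1" if R: "R > 0" for R
    proof -
      have S: "{0..R} \<in> sets ?M" "emeasure ?M {0..R} < \<infinity>"
        using Icc_sets_BK_haar[of 0] emeasure_BK_haar_Icc_finite[OF \<nu>, of 0] by simp_all
      have "(LINT y:{0..R}|?M. BK_char \<nu> l y) = (LINT y:{0..R}|?M. 1)"
        using one by (intro set_lebesgue_integral_cong) (auto simp: S)
      also have "\<dots> = complex_of_real (measure ?M {0..R})"
        using S by (simp add: set_integral_const scaleR_conv_of_real less_top)
      finally show ?thesis
        using measure_BK_haar_disc_pos[OF \<nu> R] by (simp add: u BK_char_Linfty[OF \<nu> l] BK_average_def)
    qed
    then have "\<forall>\<^sub>F R in F. u R (BK_char \<nu> l) = 1"
      by (intro filter_leD[OF F(2)] eventually_mono[OF eventually_gt_at_top[of 0]])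
    from tendsto_unique[OF F(1) m tendsto_eventually[OF this]] show ?thesis .
  qed
  moreover have "m (?T x f) = BK_char \<nu> l x * m f" if f: "f \<in> Linfty ?M" and x: "x \<in> space ?M" for f x
  proof -
    have x0: "x \<ge> 0" using x by simp
    have T: "?T x f \<in> Linfty ?M" by (rule translation_Linfty[OF \<nu> x0 f])
    have "((\<lambda>R. u R (?T x f) - u R f) \<longlongrightarrow> 0) at_top"
    proof (cases "x = 0")
      case True
      have "(LINT y:{0..R}|?M. ?T x f y) = (LINT y:{0..R}|?M. f y)" for R
        using True translation_0[OF \<nu> Linfty_measurable[OF f]]
        by (intro set_lebesgue_integral_cong) (auto intro: Icc_sets_BK_haar)
      then show ?thesis by (simp add: u f T BK_average_def)
    next
      case False
      then have x1: "x > 0" using x0 by simp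
      let ?C = "Linfty_norm ?M f"
      have "((\<lambda>R. ?C * (measure ?M {R - x..R + x} / measure ?M {0..R})) \<longlongrightarrow> ?C * 0) at_top"
        by (intro tendsto_intros annulus_ratio_tendsto_0 \<nu> x1)
      then have lim: "((\<lambda>R. ?C * (measure ?M {R - x..R + x} / measure ?M {0..R})) \<longlongrightarrow> 0) at_top"
        by simp
      show ?thesis
      proof (rule Lim_null_comparison[OF _ lim])
        show "\<forall>\<^sub>F R in at_top. norm (u R (?T x f) - u R f)
            \<le> ?C * (measure ?M {R - x..R + x} / measure ?M {0..R})"
          using eventually_ge_at_top[of x]
        proof eventually_elim
          case (elim R)
          have "norm (u R (?T x f) - u R f)
              = cmod ((LINT y:{0..R}|?M. ?T x f y) - (LINT y:{0..R}|?M. f y)) / measure ?M {0..R}"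
            by (simp add: u f T BK_average_def norm_divide flip: diff_divide_distrib)
          also have "\<dots> \<le> ?C * measure ?M {R - x..R + x} / measure ?M {0..R}"
            by (intro divide_right_mono translation_average_diff[OF \<nu> x1 elim Linfty_measurable[OF f]
                AE_Linfty_norm[OF f] Linfty_norm_nonneg[OF f]]) simp
          finally show ?case by simp
        qed
      qed
    qed
    \<comment> \<open>Only this difference converges along \<open>at_top\<close>; the averages
      themselves need not, and their limits exist along the finer filter F.\<close>
    then have "((\<lambda>R. u R (?T x f) - u R f) \<longlongrightarrow> 0) F"
      using F(2) by (rule filterlim_mono[OF _ order_refl])
    from tendsto_unique[OF F(1) this tendsto_diff[OF m m]] show ?thesis
      using one[OF x0] by simp
  qed
  ultimately show ?thesis
    unfolding alpha_amenable_def by blast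
qed

theorem theorem5p5:
  fixes \<nu> l :: real
  assumes "\<nu> \<ge> 0" and "l \<ge> 0"
    and "\<nu> = 0 \<or> \<nu> \<ge> 1 / 2"
  shows "alpha_amenable (BK_haar \<nu>) (BK_conv \<nu>) (BK_char \<nu> l) \<longleftrightarrow>
         (\<forall>x\<in>{0..}. BK_char \<nu> l x = 1)"
proof
  assume "alpha_amenable (BK_haar \<nu>) (BK_conv \<nu>) (BK_char \<nu> l)"
  then have "l = 0"
    using BK_not_amenable[OF assms(1), of l] assms(2) by (cases "l > 0") auto
  then show "\<forall>x\<in>{0..}. BK_char \<nu> l x = 1" by (simp add: BK_char_def)
next
  assume "\<forall>x\<in>{0..}. BK_char \<nu> l x = 1"
  then show "alpha_amenable (BK_haar \<nu>) (BK_conv \<nu>) (BK_char \<nu> l)"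
    by (intro BK_amenable[OF assms(1,2)]) auto
qed

end
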